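(* Let $\Delta t>0$ and $n\ge0$. Given $u_h^n\in V_h$ and $U^n\in C^0(\Omega)$, consider the scheme: find $u_h^{n+1}\in V_h$ and $U^{n+1}\in C^0(\Omega)$ such that for all $\phi\in V_h$ $$\left(\frac{u_h^{n+1}-u_h^n}{\Delta t},\phi\right)=-A(\epsilon^2;u_h^{n+1},\phi)-\left(H(u_h^n)U^{n+1},\phi\right),$$ $$U_h^n=\Pi U^n,\qquad\frac{U^{n+1}-U_h^n}{\Delta t}=\frac12H(u_h^n)\frac{u_h^{n+1}-u_h^n}{\Delta t}\quad\text{(pointwise)}.$$ Then the scheme admits a unique solution $u_h^{n+1}\in V_h$, $U^{n+1}\in C^0(\Omega)$, and, with $U_h^{n+1}=\Pi U^{n+1}$, it satisfies the energy dissipation law $$E(u_h^{n+1},U_h^{n+1})\le E(u_h^{n+1},U^{n+1})=E(u_h^n,U_h^n)-\frac1{\Delta t}\|u_h^{n+1}-u_h^n\|^2-\frac12A(\epsilon^2;u_h^{n+1}-u_h^n,u_h^{n+1}-u_h^n)-\|U^{n+1}-U_h^n\|^2.$$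
   Context: $\Omega\subset\mathbb{R}^d$ ($d=2,3$) is a bounded domain and $\epsilon>0$ is a constant. $\mathcal T$ is a quasi-uniform triangulation $\Omega=\cup_{i=1}^N T_i$, and $V_h=\{v\in C^0(\Omega)\cap H^1(\Omega): v|_{T_i}\in P_k\ \forall T_i\in\mathcal T\}$, where $P_k$ is the space of polynomials of degree at most $k$ ($k\ge1$ fixed). $C^0(\Omega)$ denotes functions continuous on $\overline\Omega$. $(\cdot,\cdot)$ and $\|\cdot\|$ are the $L^2(\Omega)$ inner product and norm. $\Pi$ is the $L^2(\Omega)$-orthogonal projection onto $V_h$. For a coefficient $a(x)$, $A(a;q,v)=\int_\Omega a(x)\nabla q\cdot\nabla v\,dx$. The potential $F$ is a $C^1$ function on an interval $I\subseteq\mathbb{R}$ (e.g. $F(u)=\frac14(u^2-1)^2$ with $I=\mathbb{R}$, or the logarithmic Flory–Huggins potential with $I=(0,1)$). The constant $B\ge0$ is such that $F+B>0$, and $H(w)=F'(w)/\sqrt{F(w)+B}$. It is a standing assumption that all functions at which $F,F',H$ are evaluated take values (on $\overline\Omega$) where these are defined and $F+B>0$. The energy is $E(v,V)=\frac12A(\epsilon^2;v,v)+\int_\Omega V^2\,dx-B|\Omega|$. *)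

theory Defs
  imports "HOL-Analysis.Analysis"
begin

definition sq_integrable :: "(real^'d) set \<Rightarrow> (real^'d \<Rightarrow> real) \<Rightarrow> bool" where
  "sq_integrable \<Omega> f \<longleftrightarrow>
     f \<in> borel_measurable (lebesgue_on \<Omega>) \<and> integrable (lebesgue_on \<Omega>) (\<lambda>x. (f x)\<^sup>2)"

definition l2_inner :: "(real^'d) set \<Rightarrow> (real^'d \<Rightarrow> real) \<Rightarrow> (real^'d \<Rightarrow> real) \<Rightarrow> real" where
  "l2_inner \<Omega> f g = (LINT x|lebesgue_on \<Omega>. f x * g x)"

definition l2_norm :: "(real^'d) set \<Rightarrow> (real^'d \<Rightarrow> real) \<Rightarrow> real" where
  "l2_norm \<Omega> f = sqrt (l2_inner \<Omega> f f)"

definition partial_deriv :: "'d \<Rightarrow> (real^'d \<Rightarrow> real) \<Rightarrow> real^'d \<Rightarrow> real" where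
  "partial_deriv i f x = frechet_derivative f (at x) (axis i 1)"

primrec Ck :: "nat \<Rightarrow> (real^'d \<Rightarrow> real) \<Rightarrow> bool" where
  "Ck 0 f \<longleftrightarrow> continuous_on UNIV f"
| "Ck (Suc m) f \<longleftrightarrow> (\<forall>x. f differentiable (at x)) \<and> (\<forall>i. Ck m (partial_deriv i f))"

definition test_function :: "(real^'d) set \<Rightarrow> (real^'d \<Rightarrow> real) \<Rightarrow> bool" where
  "test_function \<Omega> \<psi> \<longleftrightarrow>
     (\<forall>m. Ck m \<psi>) \<and> (\<exists>K. compact K \<and> K \<subseteq> \<Omega> \<and> (\<forall>x. x \<notin> K \<longrightarrow> \<psi> x = 0))"

definition has_weak_gradient ::
    "(real^'d) set \<Rightarrow> (real^'d \<Rightarrow> real) \<Rightarrow> (real^'d \<Rightarrow> real^'d) \<Rightarrow> bool" where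
  "has_weak_gradient \<Omega> v G \<longleftrightarrow>
     (\<forall>i. sq_integrable \<Omega> (\<lambda>x. G x $ i)) \<and>
     (\<forall>\<psi> i. test_function \<Omega> \<psi> \<longrightarrow>
        (LINT x|lebesgue_on \<Omega>. v x * partial_deriv i \<psi> x)
          = - (LINT x|lebesgue_on \<Omega>. G x $ i * \<psi> x))"

definition H1 :: "(real^'d) set \<Rightarrow> (real^'d \<Rightarrow> real) set" where
  "H1 \<Omega> = {v. sq_integrable \<Omega> v \<and> (\<exists>G. has_weak_gradient \<Omega> v G)}"

text \<open>On an open set the weak gradient is unique up to a null set, so integrals of it
  do not depend on the choice of representative made here.\<close>

definition weak_grad :: "(real^'d) set \<Rightarrow> (real^'d \<Rightarrow> real) \<Rightarrow> real^'d \<Rightarrow> real^'d" where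
  "weak_grad \<Omega> v = (SOME G. has_weak_gradient \<Omega> v G)"

definition dform ::
    "(real^'d) set \<Rightarrow> (real^'d \<Rightarrow> real) \<Rightarrow> (real^'d \<Rightarrow> real) \<Rightarrow> (real^'d \<Rightarrow> real) \<Rightarrow> real" where
  "dform \<Omega> a q v = (LINT x|lebesgue_on \<Omega>. a x * (weak_grad \<Omega> q x \<bullet> weak_grad \<Omega> v x))"

text \<open>Quasi-uniformity with constant \<open>\<sigma>\<close>: every element contains balls of radius
  comparable to the global mesh size, the largest element diameter. This comprises both
  shape regularity and comparability of the element sizes. The triangulation is conforming
  (built into the library notion \<open>triangulation\<close>) and consists of closed \<open>d\<close>-simplices,
  whence it covers the closure of \<open>\<Omega>\<close>.\<close>

definition quasi_uniform :: "real \<Rightarrow> (real^'d) set set \<Rightarrow> bool" where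
  "quasi_uniform \<sigma> \<T> \<longleftrightarrow>
     (\<forall>T\<in>\<T>. Max (diameter ` \<T>) \<le> \<sigma> * Sup {r. 0 \<le> r \<and> (\<exists>c. cball c r \<subseteq> T)})"

definition mesh_of :: "(real^'d) set \<Rightarrow> (real^'d) set set \<Rightarrow> bool" where
  "mesh_of \<Omega> \<T> \<longleftrightarrow>
     triangulation \<T> \<and> (\<forall>T\<in>\<T>. int CARD('d) simplex T) \<and> \<Union>\<T> = closure \<Omega>"

definition polys :: "nat \<Rightarrow> (real^'d \<Rightarrow> real) set" where
  "polys k = {p. \<exists>c :: ('d \<Rightarrow> nat) \<Rightarrow> real. \<forall>x.
      p x = (\<Sum>\<alpha> | (\<Sum>i\<in>UNIV. \<alpha> i) \<le> k. c \<alpha> * (\<Prod>i\<in>UNIV. (x $ i) ^ \<alpha> i))}"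

text \<open>A function on the closure of \<open>\<Omega>\<close> is represented by its extension by zero, so that
  equality of functions on the closure is equality in HOL.\<close>

definition C0 :: "(real^'d) set \<Rightarrow> (real^'d \<Rightarrow> real) set" where
  "C0 \<Omega> = {v. continuous_on (closure \<Omega>) v \<and> (\<forall>x. x \<notin> closure \<Omega> \<longrightarrow> v x = 0)}"

definition fe_space :: "(real^'d) set \<Rightarrow> (real^'d) set set \<Rightarrow> nat \<Rightarrow> (real^'d \<Rightarrow> real) set" where
  "fe_space \<Omega> \<T> k = {v \<in> C0 \<Omega> \<inter> H1 \<Omega>. \<forall>T\<in>\<T>. \<exists>p\<in>polys k. \<forall>x\<in>T. v x = p x}"

definition l2_proj ::
    "(real^'d) set \<Rightarrow> (real^'d \<Rightarrow> real) set \<Rightarrow> (real^'d \<Rightarrow> real) \<Rightarrow> real^'d \<Rightarrow> real" where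
  "l2_proj \<Omega> V f = (THE p. p \<in> V \<and> (\<forall>\<phi>\<in>V. l2_inner \<Omega> (\<lambda>x. f x - p x) \<phi> = 0))"

definition Hfun :: "(real \<Rightarrow> real) \<Rightarrow> (real \<Rightarrow> real) \<Rightarrow> real \<Rightarrow> real \<Rightarrow> real" where
  "Hfun F F' B w = F' w / sqrt (F w + B)"

definition energy ::
    "(real^'d) set \<Rightarrow> real \<Rightarrow> real \<Rightarrow> (real^'d \<Rightarrow> real) \<Rightarrow> (real^'d \<Rightarrow> real) \<Rightarrow> real" where
  "energy \<Omega> \<epsilon> B v V =
     1/2 * dform \<Omega> (\<lambda>_. \<epsilon>\<^sup>2) v v + (LINT x|lebesgue_on \<Omega>. (V x)\<^sup>2) - B * measure lebesgue \<Omega>"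

text \<open>\<open>(u, U)\<close> are the data at time level \<open>n\<close>, \<open>(u', U')\<close> the unknowns at level \<open>n + 1\<close>;
  \<open>Vh\<close> is the finite element space and \<open>H\<close> the nonlinearity.\<close>

definition scheme_step ::
    "(real^'d) set \<Rightarrow> (real^'d \<Rightarrow> real) set \<Rightarrow> real \<Rightarrow> (real \<Rightarrow> real) \<Rightarrow> real \<Rightarrow>
     (real^'d \<Rightarrow> real) \<Rightarrow> (real^'d \<Rightarrow> real) \<Rightarrow> (real^'d \<Rightarrow> real) \<Rightarrow> (real^'d \<Rightarrow> real) \<Rightarrow> bool" where
  "scheme_step \<Omega> Vh \<epsilon> H \<Delta>t u U u' U' \<longleftrightarrow>
     u' \<in> Vh \<and> U' \<in> C0 \<Omega> \<and>
     (\<forall>\<phi>\<in>Vh. l2_inner \<Omega> (\<lambda>x. (u' x - u x) / \<Delta>t) \<phi>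
        = - dform \<Omega> (\<lambda>_. \<epsilon>\<^sup>2) u' \<phi> - l2_inner \<Omega> (\<lambda>x. H (u x) * U' x) \<phi>) \<and>
     (\<forall>x\<in>closure \<Omega>. (U' x - l2_proj \<Omega> Vh U x) / \<Delta>t = 1/2 * H (u x) * ((u' x - u x) / \<Delta>t))"

end

theory Submission
  imports Defs
begin

text \<open>Each time step is linear in the new unknowns, because \<open>H\<close> is evaluated at
  the old \<open>u\<close>. The auxiliary equation is pointwise, so it determines
  \<open>U' = \<Pi> U + 1/2 H(u) (u' - u)\<close> once \<open>u'\<close> is known. Inserting this into the first equation
  leaves one variational problem in \<open>V\<^sub>h\<close> for the increment \<open>d = u' - u\<close>:
  \<open>(d, \<phi>)/\<Delta>t + A(\<epsilon>\<^sup>2; d, \<phi>) + 1/2 (H(u) d, H(u) \<phi>) = - A(\<epsilon>\<^sup>2; u, \<phi>) - (H(u) \<Pi> U, \<phi>)\<close>.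
  The form on the left is symmetric and, because of its first term, positive definite. The space
  \<open>V\<^sub>h\<close> is finite-dimensional, so there is exactly one solution (lemmas \<open>Vh_riesz\<close>,
  \<open>incr_unique_solution\<close>); that \<open>V\<^sub>h\<close> consists of functions continuous up to the boundary makes
  \<open>U'\<close> continuous as well.

  The energy law is the first equation tested with \<open>d\<close>. The term \<open>(H(u) U', d)\<close> becomes
  \<open>2 (U', U' - \<Pi> U)\<close> by the auxiliary equation, and two polarisation identities
  \<open>2 (b, b - a) = (b, b) - (a, a) + (b - a, b - a)\<close>, one for \<open>A\<close> and one for the \<open>L\<^sup>2\<close> product,
  turn it into the asserted balance (lemma \<open>energy_law\<close>). Passing from \<open>U'\<close> to \<open>\<Pi> U'\<close> can only
  decrease the energy since an orthogonal projection is a contraction.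

  The analytical work lies in the bilinearity of \<open>A\<close>: it is built from an arbitrarily chosen weak
  gradient, so linearity rests on the uniqueness of weak gradients up to null sets. This is
  the fundamental lemma of the calculus of variations (\<open>AE_0_of_test_functions\<close>). It is proved
  here with explicit smooth functions that converge boundedly to the indicator of a box, so that a
  function orthogonal to all test functions has integral zero over every small box, hence over
  every Borel set.\<close>

section \<open>Smooth test functions\<close>

lemma partial_deriv_eq:
  assumes "(f has_derivative f') (at x)"
  shows "partial_deriv i f x = f' (axis i 1)"
  using frechet_derivative_at[OF assms] by (simp add: partial_deriv_def)

lemma Ck_Suc_D: "Ck (Suc m) f \<Longrightarrow> Ck m f"
proof (induction m arbitrary: f)
  case 0
  then show ?case
    by (auto simp: continuous_on_eq_continuous_at intro: differentiable_imp_continuous_within)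
qed auto

lemma Ck_continuous: "Ck m f \<Longrightarrow> continuous_on UNIV f"
  by (induction m arbitrary: f)
     (auto simp: continuous_on_eq_continuous_at intro: differentiable_imp_continuous_within)

lemma Ck_const: "Ck m (\<lambda>_. c :: real)"
proof (induction m arbitrary: c)
  case (Suc m)
  have "partial_deriv i (\<lambda>_. c :: real) = (\<lambda>_. 0)" for i :: 'a
    by (rule ext, subst partial_deriv_eq[of _ "\<lambda>_. 0"]) auto
  then show ?case
    using Suc.IH[of 0] by simp
qed simp

lemma Ck_add: "Ck m f \<Longrightarrow> Ck m g \<Longrightarrow> Ck m (\<lambda>x. f x + g x)"
proof (induction m arbitrary: f g)
  case 0
  then show ?case by (auto intro: continuous_intros)
next
  case (Suc m)
  have "partial_deriv i (\<lambda>x. f x + g x) = (\<lambda>x. partial_deriv i f x + partial_deriv i g x)" for i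
  proof
    fix x
    have "(f has_derivative frechet_derivative f (at x)) (at x)"
      "(g has_derivative frechet_derivative g (at x)) (at x)"
      using Suc.prems by (auto simp: frechet_derivative_works[symmetric])
    from has_derivative_add[OF this]
    show "partial_deriv i (\<lambda>x. f x + g x) x = partial_deriv i f x + partial_deriv i g x"
      by (subst partial_deriv_eq) (auto simp: partial_deriv_def)
  qed
  then show ?case
    using Suc by auto
qed

lemma Ck_mult: "Ck m f \<Longrightarrow> Ck m g \<Longrightarrow> Ck m (\<lambda>x. f x * g x)"
proof (induction m arbitrary: f g)
  case 0
  then show ?case by (auto intro: continuous_intros)
next
  case (Suc m)
  have "partial_deriv i (\<lambda>x. f x * g x) = (\<lambda>x. f x * partial_deriv i g x + partial_deriv i f x * g x)" for i
  proof
    fix x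
    have "(f has_derivative frechet_derivative f (at x)) (at x)"
      "(g has_derivative frechet_derivative g (at x)) (at x)"
      using Suc.prems by (auto simp: frechet_derivative_works[symmetric])
    from has_derivative_mult[OF this]
    show "partial_deriv i (\<lambda>x. f x * g x) x = f x * partial_deriv i g x + partial_deriv i f x * g x"
      by (subst partial_deriv_eq) (auto simp: partial_deriv_def)
  qed
  then show ?case
    using Suc Ck_Suc_D[OF Suc.prems(1)] Ck_Suc_D[OF Suc.prems(2)] by (auto intro!: Ck_add)
qed

lemma Ck_prod: "(\<And>i. i \<in> A \<Longrightarrow> Ck m (f i)) \<Longrightarrow> Ck m (\<lambda>x. \<Prod>i\<in>A. f i x)"
  by (induction A rule: infinite_finite_induct) (auto intro: Ck_mult Ck_const)

text \<open>A whole sequence \<open>h\<close> of successive derivatives is carried along, so that the induction hypothesis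
  for \<open>h (Suc j)\<close> is available when \<open>h j\<close> has been differentiated once.\<close>

lemma Ck_ridge:
  fixes h :: "nat \<Rightarrow> real \<Rightarrow> real" and v :: "real^'d"
  assumes "\<And>j t. (h j has_real_derivative h (Suc j) t) (at t)"
  shows "Ck m (\<lambda>x. h j (x \<bullet> v + e))"
proof (induction m arbitrary: j)
  case 0
  have "continuous_on UNIV (h j)"
    by (meson assms DERIV_isCont continuous_at_imp_continuous_on)
  then show ?case
    by (auto intro!: continuous_on_compose2[of UNIV "h j"] continuous_intros)
next
  case (Suc m)
  have *: "((\<lambda>x. h j (x \<bullet> v + e)) has_derivative (\<lambda>y. (y \<bullet> v) * h (Suc j) (x \<bullet> v + e))) (at x)" for x
  proof -
    have "((\<lambda>x. x \<bullet> v + e) has_derivative (\<lambda>y. y \<bullet> v)) (at x)"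
      by (auto intro!: derivative_eq_intros)
    from has_derivative_compose[OF this assms[THEN has_field_derivative_imp_has_derivative]]
    show ?thesis by (simp add: mult.commute)
  qed
  have "partial_deriv i (\<lambda>x. h j (x \<bullet> v + e)) = (\<lambda>x. (axis i 1 \<bullet> v) * h (Suc j) (x \<bullet> v + e))" for i
    by (rule ext, subst partial_deriv_eq[OF *]) simp
  then show ?case
    using * Suc.IH[of "Suc j"] by (auto intro!: Ck_mult Ck_const simp: differentiable_def)
qed

text \<open>The classical smooth function \<open>exp (- 1/t)\<close>, flat at \<open>0\<close>, with a polynomial factor in \<open>1/t\<close>:
  this family is closed under differentiation.\<close>

definition flat_exp :: "real poly \<Rightarrow> real \<Rightarrow> real" where
  "flat_exp P t = (if t \<le> 0 then 0 else poly P (inverse t) * exp (- inverse t))"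

lemma poly_exp_tendsto_0: "((\<lambda>s. poly P s * exp (- s)) \<longlongrightarrow> (0::real)) at_top"
proof -
  have "((\<lambda>s. \<Sum>i\<le>degree P. coeff P i * (s ^ i / exp s)) \<longlongrightarrow> (\<Sum>i\<le>degree P. coeff P i * 0)) at_top"
    by (intro tendsto_intros tendsto_power_div_exp_0)
  then show ?thesis
    by (simp add: poly_altdef exp_minus divide_inverse sum_distrib_right mult.assoc)
qed

text \<open>For \<open>t > 0\<close> this is the product rule, the factor \<open>1/t\<^sup>2\<close> coming from the chain rule. At \<open>t = 0\<close> the
  difference quotient is again of the form polynomial in \<open>1/t\<close> times \<open>exp (- 1/t)\<close>, and tends to \<open>0\<close>.\<close>

lemma flat_exp_deriv:
  "(flat_exp P has_real_derivative flat_exp ([:0, 0, 1:] * (P - pderiv P)) t) (at t)"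
proof -
  consider "t < 0" | "t > 0" | "t = 0" by linarith
  then show ?thesis
  proof cases
    case 1
    have "(flat_exp P has_real_derivative 0) (at t)"
      by (rule has_field_derivative_transform_within_open[of "\<lambda>_. 0" 0 t "{..<0}"])
         (use 1 in \<open>auto simp: flat_exp_def\<close>)
    then show ?thesis using 1 by (simp add: flat_exp_def)
  next
    case 2
    have "((\<lambda>t. poly P (inverse t) * exp (- inverse t)) has_real_derivative
        flat_exp ([:0, 0, 1:] * (P - pderiv P)) t) (at t)"
      using 2 by (auto intro!: derivative_eq_intros DERIV_chain2[OF poly_DERIV]
          simp: flat_exp_def field_simps power2_eq_square)
    then show ?thesis
      by (rule has_field_derivative_transform_within_open[of _ _ t "{0<..}"])
         (use 2 in \<open>auto simp: flat_exp_def\<close>)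
  next
    case 3
    have "((\<lambda>h. poly (pCons 0 P) (inverse h) * exp (- inverse h)) \<longlongrightarrow> 0) (at_right (0::real))"
      by (rule filterlim_compose[OF poly_exp_tendsto_0 filterlim_inverse_at_top_right])
    then have "((\<lambda>h. flat_exp P h / h) \<longlongrightarrow> 0) (at_right 0)"
      by (rule Lim_transform_eventually)
         (auto simp: eventually_at_filter flat_exp_def divide_inverse mult_ac)
    moreover have "((\<lambda>h. flat_exp P h / h) \<longlongrightarrow> 0) (at_left 0)"
      by (rule tendsto_eventually) (auto simp: eventually_at_filter flat_exp_def)
    ultimately have "((\<lambda>h. flat_exp P h / h) \<longlongrightarrow> 0) (at 0)"
      by (simp add: filterlim_split_at)
    then show ?thesis
      using 3 by (simp add: DERIV_def flat_exp_def)
  qed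
qed

abbreviation smooth_step :: "real \<Rightarrow> real" where
  "smooth_step \<equiv> flat_exp 1"

lemma smooth_step_bounds: "0 \<le> smooth_step t" "smooth_step t \<le> 1"
  by (auto simp: flat_exp_def)

lemma smooth_step_Ck: "Ck m (\<lambda>x. smooth_step (x \<bullet> v + e))"
proof -
  define P :: "nat \<Rightarrow> real poly" where
    "P = rec_nat 1 (\<lambda>_ p. [:0, 0, 1:] * (p - pderiv p))"
  have "(flat_exp (P j) has_real_derivative flat_exp (P (Suc j)) t) (at t)" for j t
    using flat_exp_deriv[of "P j" t] by (simp add: P_def)
  from Ck_ridge[of "\<lambda>j. flat_exp (P j)", OF this, of m 0 v e] show ?thesis
    by (simp add: P_def)
qed

text \<open>For \<open>t > 0\<close> stretching the argument makes \<open>exp (- 1/(n t))\<close> increase to \<open>1\<close>: rescaling alone turns the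
  step into an approximation of the indicator of a half-line.\<close>

lemma smooth_step_scaled_tendsto:
  "(\<lambda>n. smooth_step (real n * t)) \<longlonglongrightarrow> (if t > 0 then 1 else 0)"
proof (cases "t > 0")
  case True
  have "filterlim (\<lambda>n. real n * t) at_top sequentially"
    using True by (simp add: filterlim_tendsto_pos_mult_at_top[OF tendsto_const True] filterlim_real_sequentially mult.commute)
  then have "(\<lambda>n. exp (- inverse (real n * t))) \<longlonglongrightarrow> exp (- 0)"
    by (intro tendsto_intros tendsto_inverse_0_at_top)
  then have "(\<lambda>n. exp (- inverse (real n * t))) \<longlonglongrightarrow> 1" by simp
  moreover have "\<forall>\<^sub>F n in sequentially. exp (- inverse (real n * t)) = smooth_step (real n * t)"
    using eventually_gt_at_top[of 0]
    by eventually_elim (use True in \<open>auto simp: flat_exp_def mult_le_0_iff\<close>)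
  ultimately show ?thesis
    using True by (auto intro: Lim_transform_eventually)
qed (auto simp: flat_exp_def mult_le_0_iff intro!: tendsto_eventually)

text \<open>A product of \<open>2 d\<close> smooth steps, one for each face of the box.\<close>

definition box_bump :: "real^'d \<Rightarrow> real^'d \<Rightarrow> nat \<Rightarrow> real^'d \<Rightarrow> real" where
  "box_bump a b n x =
     (\<Prod>i\<in>UNIV. smooth_step (real n * (x $ i - a $ i)) * smooth_step (real n * (b $ i - x $ i)))"

lemma box_bump_bounds: "0 \<le> box_bump a b n x" "box_bump a b n x \<le> 1"
  unfolding box_bump_def
  by (auto intro!: prod_nonneg prod_le_1 mult_le_one smooth_step_bounds mult_nonneg_nonneg)

lemma test_function_box_bump:
  assumes "cbox a b \<subseteq> \<Omega>"
  shows "test_function \<Omega> (box_bump a b n)"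
  unfolding test_function_def
proof (intro conjI allI exI[of _ "cbox a b"] impI)
  fix m
  have "(\<lambda>x. smooth_step (real n * (x $ i - a $ i)))
      = (\<lambda>x. smooth_step (x \<bullet> (real n *\<^sub>R axis i 1) + - real n * a $ i))"
    "(\<lambda>x. smooth_step (real n * (b $ i - x $ i)))
      = (\<lambda>x. smooth_step (x \<bullet> (- real n *\<^sub>R axis i 1) + real n * b $ i))" for i
    by (simp_all add: inner_axis algebra_simps)
  then have "Ck m (\<lambda>x. smooth_step (real n * (x $ i - a $ i)))"
    "Ck m (\<lambda>x. smooth_step (real n * (b $ i - x $ i)))" for i
    by (simp_all only: smooth_step_Ck)
  then show "Ck m (box_bump a b n)"
    unfolding box_bump_def[abs_def] by (auto intro!: Ck_prod Ck_mult)
next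
  fix x assume "x \<notin> cbox a b"
  then obtain i where "x $ i < a $ i \<or> b $ i < x $ i"
    by (auto simp: mem_box_cart not_le)
  then have "smooth_step (real n * (x $ i - a $ i)) * smooth_step (real n * (b $ i - x $ i)) = 0"
    by (auto simp: flat_exp_def mult_le_0_iff)
  then show "box_bump a b n x = 0"
    unfolding box_bump_def by (intro prod_zero) auto
qed (use assms in auto)

lemma box_bump_tendsto: "(\<lambda>n. box_bump a b n x) \<longlonglongrightarrow> indicator (box a b) x"
proof -
  have eq: "indicator (box a b) x
      = (\<Prod>i\<in>UNIV. (if x $ i - a $ i > 0 then 1 else 0) * (if b $ i - x $ i > 0 then 1 else 0 :: real))"
    by (auto simp: indicator_def mem_box_cart)
  show ?thesis
    unfolding box_bump_def eq by (intro tendsto_intros smooth_step_scaled_tendsto)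
qed

section \<open>The fundamental lemma of the calculus of variations\<close>

text \<open>The functions \<open>box_bump a b n\<close> are test functions bounded by \<open>1\<close> and converge pointwise to the
  indicator of the box; dominated convergence passes the vanishing integrals to the limit.\<close>

lemma integral_box_eq_0_of_test_functions:
  fixes g :: "real^'d \<Rightarrow> real"
  assumes \<Omega>: "open \<Omega>" and g: "integrable (lebesgue_on \<Omega>) g"
    and zero: "\<And>\<psi>. test_function \<Omega> \<psi> \<Longrightarrow> (LINT x|lebesgue_on \<Omega>. g x * \<psi> x) = 0"
    and ab: "cbox a b \<subseteq> \<Omega>"
  shows "(LINT x|lebesgue_on \<Omega>. g x * indicator (box a b) x) = 0"
proof -
  have [measurable]: "\<Omega> \<in> sets lebesgue" "box a b \<in> sets lebesgue"
    using \<Omega> by auto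
  have cont: "continuous_on UNIV (box_bump a b n)" for n
    using test_function_box_bump[OF ab, of n] unfolding test_function_def by (blast intro: Ck_continuous)
  have [measurable]: "box_bump a b n \<in> borel_measurable (lebesgue_on \<Omega>)" for n
    by (intro continuous_imp_measurable_on_sets_lebesgue continuous_on_subset[OF cont]) auto
  have [measurable]: "indicator (box a b) \<in> borel_measurable (lebesgue_on \<Omega>)"
    by (intro measurable_restrict_space1) auto
  have [measurable]: "g \<in> borel_measurable (lebesgue_on \<Omega>)"
    using g by auto
  have "(\<lambda>n. LINT x|lebesgue_on \<Omega>. g x * box_bump a b n x)
      \<longlonglongrightarrow> (LINT x|lebesgue_on \<Omega>. g x * indicator (box a b) x)"
  proof (rule integral_dominated_convergence[where w = "\<lambda>x. \<bar>g x\<bar>"])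
    show "AE x in lebesgue_on \<Omega>. (\<lambda>n. g x * box_bump a b n x) \<longlonglongrightarrow> g x * indicator (box a b) x"
      by (intro always_eventually allI tendsto_intros box_bump_tendsto)
    show "AE x in lebesgue_on \<Omega>. norm (g x * box_bump a b n x) \<le> \<bar>g x\<bar>" for n
      using box_bump_bounds[of a b n] by (auto simp: abs_mult intro!: mult_left_le)
  qed (use g in auto)
  moreover have "(LINT x|lebesgue_on \<Omega>. g x * box_bump a b n x) = 0" for n
    by (rule zero[OF test_function_box_bump[OF ab]])
  ultimately show ?thesis
    by (simp add: LIMSEQ_const_iff)
qed

text \<open>Boxes form an intersection-stable generator of the Borel sets, so Dynkin's argument extends the
  vanishing of the integral from boxes to all Borel sets, and those determine the density.\<close>

lemma AE_0_of_integral_boxes_0: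
  fixes f :: "'a::euclidean_space \<Rightarrow> real"
  assumes f: "integrable lborel f"
    and box: "\<And>c d. (LINT x:box c d|lborel. f x) = 0"
  shows "AE x in lborel. f x = 0"
proof (rule density_unique_real[OF f])
  fix A :: "'a set" assume "A \<in> sets lborel"
  then have A: "A \<in> sigma_sets UNIV (range (\<lambda>(a, b). box a b))"
    by (simp add: borel_eq_box)
  have stable: "Int_stable (range (\<lambda>(a, b). box a b :: 'a set))"
    by (auto simp: Int_stable_def box_Int_box)
  have sI: "set_integrable lborel S f" if "S \<in> sets borel" for S
    using f that unfolding set_integrable_def by (intro integrable_mult_indicator) auto
  have UN: "(\<Union>n::nat. box (- (real n *\<^sub>R One)) (real n *\<^sub>R One)) = (UNIV :: 'a set)"
    by (rule UN_box_eq_UNIV)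
  \<comment> \<open>The step for complements compares with the integral over the whole space, which vanishes as a limit over growing boxes.\<close>
  have total: "(LINT x:UNIV|lborel. f x) = 0"
  proof -
    have "(\<lambda>n. LINT x:box (- (real n *\<^sub>R One)) (real n *\<^sub>R One)|lborel. f x)
        \<longlonglongrightarrow> (LINT x:(\<Union>n::nat. box (- (real n *\<^sub>R One)) (real n *\<^sub>R One))|lborel. f x)"
    proof (rule set_integral_cont_up)
      show "incseq (\<lambda>n. box (- (real n *\<^sub>R One)) (real n *\<^sub>R One :: 'a))"
        by (auto simp: incseq_def mem_box) (smt (verit) of_nat_mono)+
    qed (use sI in auto)
    then show ?thesis
      unfolding UN box by (simp add: LIMSEQ_const_iff)
  qed
  have "range (\<lambda>(a, b). box a b :: 'a set) \<subseteq> Pow UNIV" by simp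
  from stable this A have "(LINT x:A|lborel. f x) = 0"
  proof (induction rule: sigma_sets_induct_disjoint)
    case (basic A)
    then show ?case using box by auto
  next
    case (compl A)
    then have A: "A \<in> sets borel" by (simp add: borel_eq_box)
    then have "(LINT x:A \<union> (UNIV - A)|lborel. f x) = (LINT x:A|lborel. f x) + (LINT x:UNIV - A|lborel. f x)"
      by (intro set_integral_Un sI) auto
    then show ?case using compl total by simp
  next
    case (union A)
    then have "\<And>i. A i \<in> sets borel" by (simp add: borel_eq_box image_subset_iff)
    then show ?case
      using union by (subst lebesgue_integral_countable_add)
        (auto intro!: sI simp: disjoint_family_on_def)
  qed (simp add: set_lebesgue_integral_def)
  then show "(LINT x:A|lborel. f x) = (LINT x:A|lborel. 0)"
    by simp
qed auto

lemma box_Int_box_inside: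
  fixes a b c d :: "'a::euclidean_space"
  assumes "cbox a b \<subseteq> S"
  obtains e f where "box a b \<inter> box c d = box e f" "cbox e f \<subseteq> S"
proof
  show "box a b \<inter> box c d =
      box (\<Sum>i\<in>Basis. max (a\<bullet>i) (c\<bullet>i) *\<^sub>R i) (\<Sum>i\<in>Basis. min (b\<bullet>i) (d\<bullet>i) *\<^sub>R i)"
    by (rule box_Int_box)
  show "cbox (\<Sum>i\<in>Basis. max (a\<bullet>i) (c\<bullet>i) *\<^sub>R i) (\<Sum>i\<in>Basis. min (b\<bullet>i) (d\<bullet>i) *\<^sub>R i) \<subseteq> S"
    using assms by (auto simp: mem_box)
qed

text \<open>The fundamental lemma of the calculus of variations. Test functions only control boxes whose closure
  lies in \<open>\<Omega>\<close>; multiplying by the indicator of one such box reduces its interior to the case of all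
  boxes, and countably many of them cover \<open>\<Omega>\<close>.\<close>

lemma AE_0_of_test_functions:
  fixes g :: "real^'d \<Rightarrow> real"
  assumes \<Omega>: "open \<Omega>" and g: "integrable (lebesgue_on \<Omega>) g"
    and zero: "\<And>\<psi>. test_function \<Omega> \<psi> \<Longrightarrow> (LINT x|lebesgue_on \<Omega>. g x * \<psi> x) = 0"
  shows "AE x in lebesgue_on \<Omega>. g x = 0"
proof -
  have [measurable]: "\<Omega> \<in> sets lebesgue" using \<Omega> by auto
  define G where "G x = indicator \<Omega> x * g x" for x
  have G: "integrable lebesgue G"
    using g by (simp add: integrable_restrict_space G_def[abs_def])
  \<comment> \<open>The Dynkin argument runs over Borel sets, hence a Borel representative of the Lebesgue measurable function.\<close>
  then obtain G' where G'm[measurable]: "G' \<in> borel_measurable lborel" and ae: "AE x in lborel. G x = G' x"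
    using completion_ex_borel_measurable_real by blast
  have ae': "AE x in lebesgue. G x = G' x" using ae by (rule AE_completion)
  have G'm': "G' \<in> borel_measurable lebesgue" using G'm by (rule measurable_completion)
  have G'i: "integrable lebesgue G'"
    using integrable_cong_AE[OF _ G'm' ae'] G by auto
  then have G'l: "integrable lborel G'"
    by (simp add: integrable_completion)
  have box0: "(LINT x:box a b|lborel. G' x) = 0" if "cbox a b \<subseteq> \<Omega>" for a b
  proof -
    have "(LINT x:box a b|lborel. G' x) = (LINT x|lebesgue. indicator (box a b) x * G' x)"
      by (simp add: set_lebesgue_integral_def integral_completion)
    also have "\<dots> = (LINT x|lebesgue. indicator (box a b) x * G x)"
      using ae' G'i G by (intro integral_cong_AE) (auto intro!: borel_measurable_times borel_measurable_indicator)
    also have "\<dots> = (LINT x|lebesgue_on \<Omega>. g x * indicator (box a b) x)"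
      by (simp add: integral_restrict_space G_def mult_ac)
    also have "\<dots> = 0"
      by (rule integral_box_eq_0_of_test_functions) (use assms that in auto)
    finally show ?thesis .
  qed
  have local: "AE x in lborel. x \<in> box a b \<longrightarrow> G' x = 0" if ab: "cbox a b \<subseteq> \<Omega>" for a b
  proof -
    have "AE x in lborel. indicator (box a b) x *\<^sub>R G' x = 0"
    proof (rule AE_0_of_integral_boxes_0)
      show "integrable lborel (\<lambda>x. indicat_real (box a b) x *\<^sub>R G' x)"
        using G'l by (intro integrable_mult_indicator) auto
      fix c d
      obtain e f where ef: "box a b \<inter> box c d = box e f" "cbox e f \<subseteq> \<Omega>"
        using box_Int_box_inside[OF ab] by blast
      have "(LINT x:box c d|lborel. indicat_real (box a b) x *\<^sub>R G' x) = (LINT x:box e f|lborel. G' x)"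
        unfolding ef(1)[symmetric] set_lebesgue_integral_def
        by (intro Bochner_Integration.integral_cong) (auto simp: indicator_def)
      then show "(LINT x:box c d|lborel. indicat_real (box a b) x *\<^sub>R G' x) = 0"
        using box0[OF ef(2)] by simp
    qed
    then show ?thesis by eventually_elim (auto simp: indicator_def)
  qed
  define \<B> where "\<B> = {box a b | a b. cbox a b \<subseteq> \<Omega>}"
  have op: "open S" if "S \<in> \<B>" for S using that by (auto simp: \<B>_def)
  obtain \<B>' where \<B>': "\<B>' \<subseteq> \<B>" "countable \<B>'" "\<Union>\<B>' = \<Union>\<B>"
    by (rule Lindelof[OF op])
  have "x \<in> \<Union>\<B>" if "x \<in> \<Omega>" for x
  proof -
    obtain a b where "cbox a b \<subseteq> \<Omega>" "x \<in> box a b"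
      using open_contains_cbox[OF \<Omega> \<open>x \<in> \<Omega>\<close>] by metis
    then show ?thesis unfolding \<B>_def by blast
  qed
  then have cover: "\<Omega> \<subseteq> \<Union>\<B>'" using \<B>' by auto
  have "AE x in lborel. x \<in> S \<longrightarrow> G' x = 0" if "S \<in> \<B>'" for S
  proof -
    from that \<B>'(1) obtain a b where "S = box a b" "cbox a b \<subseteq> \<Omega>"
      unfolding \<B>_def by blast
    with local show ?thesis by blast
  qed
  then have "AE x in lborel. \<forall>S\<in>\<B>'. x \<in> S \<longrightarrow> G' x = 0"
    using \<B>'(2) by (rule AE_ball_countable')
  then have "AE x in lborel. x \<in> \<Omega> \<longrightarrow> g x = 0"
    using ae by eventually_elim (use cover in \<open>auto simp: G_def\<close>)
  then have "AE x in lebesgue. x \<in> \<Omega> \<longrightarrow> g x = 0" by (rule AE_completion)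
  then show ?thesis
    by (subst AE_restrict_space_iff) auto
qed

section \<open>Square integrable functions and the L2 inner product\<close>

lemma sq_integrable_mult:
  assumes "sq_integrable \<Omega> f" "sq_integrable \<Omega> g"
  shows "integrable (lebesgue_on \<Omega>) (\<lambda>x. f x * g x)"
proof (rule Bochner_Integration.integrable_bound)
  show "integrable (lebesgue_on \<Omega>) (\<lambda>x. (f x)\<^sup>2 + (g x)\<^sup>2)"
    using assms by (auto simp: sq_integrable_def)
  show "(\<lambda>x. f x * g x) \<in> borel_measurable (lebesgue_on \<Omega>)"
    using assms by (auto simp: sq_integrable_def)
  have "\<bar>s * t\<bar> \<le> s\<^sup>2 + t\<^sup>2" for s t :: real
  proof -
    have "0 \<le> (\<bar>s\<bar> - \<bar>t\<bar>)\<^sup>2" "0 \<le> \<bar>s\<bar> * \<bar>t\<bar>" by auto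
    then show ?thesis unfolding power2_diff abs_mult power2_abs by linarith
  qed
  then show "AE x in lebesgue_on \<Omega>. norm (f x * g x) \<le> norm ((f x)\<^sup>2 + (g x)\<^sup>2)"
    by (auto intro: order_trans[OF _ abs_ge_self])
qed

lemma sq_integrable_comb:
  assumes "sq_integrable \<Omega> f" "sq_integrable \<Omega> g"
  shows "sq_integrable \<Omega> (\<lambda>x. f x + t * g x)"
proof -
  have "integrable (lebesgue_on \<Omega>) (\<lambda>x. (f x)\<^sup>2 + t\<^sup>2 * (g x)\<^sup>2 + 2 * t * (f x * g x))"
    using assms sq_integrable_mult[OF assms]
    by (intro Bochner_Integration.integrable_add integrable_mult_right) (auto simp: sq_integrable_def)
  then show ?thesis
    using assms by (auto simp: sq_integrable_def power2_eq_square algebra_simps)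
qed

lemma sq_integrable_continuous:
  assumes "bounded \<Omega>" "\<Omega> \<in> sets lebesgue" "continuous_on (closure \<Omega>) f"
  shows "sq_integrable \<Omega> f"
proof -
  have meas: "f \<in> borel_measurable (lebesgue_on \<Omega>)"
    by (intro continuous_imp_measurable_on_sets_lebesgue continuous_on_subset[OF assms(3) closure_subset] assms)
  have "compact (f ` closure \<Omega>)"
    using assms by (intro compact_continuous_image) (auto simp: compact_closure)
  then obtain B where B: "\<And>x. x \<in> closure \<Omega> \<Longrightarrow> norm (f x) \<le> B"
    unfolding compact_eq_bounded_closed bounded_iff by blast
  interpret finite_measure "lebesgue_on \<Omega>"
    using assms by (intro finite_measure_lebesgue_on bounded_set_imp_lmeasurable)
  have "integrable (lebesgue_on \<Omega>) (\<lambda>x. (f x)\<^sup>2)"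
  proof (rule Bochner_Integration.integrable_bound)
    show "integrable (lebesgue_on \<Omega>) (\<lambda>x. B\<^sup>2)"
      by simp
    show "AE x in lebesgue_on \<Omega>. norm ((f x)\<^sup>2) \<le> norm (B\<^sup>2)"
      using B closure_subset by (intro AE_I2) (auto simp: abs_le_square_iff[symmetric] intro: order_trans[OF _ abs_ge_self])
  qed (use meas in auto)
  with meas show ?thesis by (simp add: sq_integrable_def)
qed

lemma l2_inner_commute: "l2_inner \<Omega> f g = l2_inner \<Omega> g f"
  by (simp add: l2_inner_def mult.commute)

lemma l2_inner_comb_left:
  assumes "sq_integrable \<Omega> f" "sq_integrable \<Omega> g" "sq_integrable \<Omega> z"
  shows "l2_inner \<Omega> (\<lambda>x. f x + t * g x) z = l2_inner \<Omega> f z + t * l2_inner \<Omega> g z"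
  using sq_integrable_mult[OF assms(1,3)] sq_integrable_mult[OF assms(2,3)]
  by (simp add: l2_inner_def distrib_right mult.assoc)

lemma l2_inner_comb_right:
  assumes "sq_integrable \<Omega> f" "sq_integrable \<Omega> g" "sq_integrable \<Omega> z"
  shows "l2_inner \<Omega> z (\<lambda>x. f x + t * g x) = l2_inner \<Omega> z f + t * l2_inner \<Omega> z g"
  using l2_inner_comb_left[OF assms] by (simp add: l2_inner_commute)

lemma l2_inner_nonneg: "l2_inner \<Omega> f f \<ge> 0"
  unfolding l2_inner_def by (intro integral_nonneg_AE) auto

lemma l2_norm_power2: "(l2_norm \<Omega> f)\<^sup>2 = l2_inner \<Omega> f f"
  by (simp add: l2_norm_def l2_inner_nonneg)

lemma C0_sq_integrable:
  "\<lbrakk>open \<Omega>; bounded \<Omega>; v \<in> C0 \<Omega>\<rbrakk> \<Longrightarrow> sq_integrable \<Omega> v"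
  by (intro sq_integrable_continuous) (auto simp: C0_def)

lemma C0_comb: "v \<in> C0 \<Omega> \<Longrightarrow> w \<in> C0 \<Omega> \<Longrightarrow> (\<lambda>x. v x + t * w x) \<in> C0 \<Omega>"
  by (auto simp: C0_def intro!: continuous_intros)

text \<open>A continuous function that vanishes almost everywhere on an open set vanishes everywhere on it, hence
  on its closure, and off the closure members of \<open>C0 \<Omega>\<close> are zero by definition.\<close>

lemma l2_inner_pos:
  assumes \<Omega>: "open \<Omega>" "bounded \<Omega>" and v: "v \<in> C0 \<Omega>" "v \<noteq> (\<lambda>_. 0)"
  shows "l2_inner \<Omega> v v > 0"
proof (rule ccontr)
  assume "\<not> ?thesis"
  then have "l2_inner \<Omega> v v = 0"
    using l2_inner_nonneg[of \<Omega> v] by simp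
  moreover have "integrable (lebesgue_on \<Omega>) (\<lambda>x. v x * v x)"
    using C0_sq_integrable[OF \<Omega> v(1)] by (intro sq_integrable_mult)
  ultimately have "AE x in lebesgue_on \<Omega>. v x * v x = 0"
    by (subst integral_nonneg_eq_0_iff_AE[symmetric]) (auto simp: l2_inner_def)
  then have ae: "AE x in lebesgue. x \<in> \<Omega> \<longrightarrow> v x = 0"
    using \<Omega> by (subst (asm) AE_restrict_space_iff) auto
  have cont: "continuous_on (closure \<Omega>) v" using v by (simp add: C0_def)
  define S where "S = {x \<in> \<Omega>. v x \<noteq> 0}"
  have "open S"
  proof -
    have "S = v -` (- {0}) \<inter> \<Omega>" by (auto simp: S_def)
    then show ?thesis
      using continuous_open_preimage[OF continuous_on_subset[OF cont closure_subset] \<Omega>(1), of "- {0}"]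
      by (simp add: Int_commute open_Compl)
  qed
  have "x \<in> {}" if "x \<in> S" for x
    by (rule mem_closed_if_AE_lebesgue_open[OF \<open>open S\<close> closed_empty _ that])
       (use ae in \<open>eventually_elim, auto simp: S_def\<close>)
  then have "v x = 0" if "x \<in> \<Omega>" for x
    using that by (auto simp: S_def)
  then have "v x = 0" if "x \<in> closure \<Omega>" for x
    using continuous_constant_on_closure[OF cont _ that] by blast
  then have "v = (\<lambda>_. 0)"
    using v by (auto simp: C0_def fun_eq_iff)
  with v show False by simp
qed

section \<open>Weak gradients and the Dirichlet form\<close>

lemma test_function_sq_integrable:
  assumes "open \<Omega>" "bounded \<Omega>" "test_function \<Omega> \<psi>"
  shows "sq_integrable \<Omega> \<psi>" "sq_integrable \<Omega> (partial_deriv i \<psi>)"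
proof -
  have "Ck 0 \<psi>" "Ck (Suc 0) \<psi>" using assms unfolding test_function_def by blast+
  then have "continuous_on UNIV \<psi>" "continuous_on UNIV (partial_deriv i \<psi>)" by auto
  then show "sq_integrable \<Omega> \<psi>" "sq_integrable \<Omega> (partial_deriv i \<psi>)"
    using assms by (auto intro!: sq_integrable_continuous intro: continuous_on_subset)
qed

lemma has_weak_gradient_comb:
  assumes \<Omega>: "open \<Omega>" "bounded \<Omega>"
    and v: "sq_integrable \<Omega> v" "has_weak_gradient \<Omega> v G"
    and w: "sq_integrable \<Omega> w" "has_weak_gradient \<Omega> w K"
  shows "has_weak_gradient \<Omega> (\<lambda>x. v x + t * w x) (\<lambda>x. G x + t *\<^sub>R K x)"
  unfolding has_weak_gradient_def
proof (intro conjI allI impI)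
  have GK: "sq_integrable \<Omega> (\<lambda>x. G x $ i)" "sq_integrable \<Omega> (\<lambda>x. K x $ i)" for i
    using v w by (auto simp: has_weak_gradient_def)
  show "sq_integrable \<Omega> (\<lambda>x. (G x + t *\<^sub>R K x) $ i)" for i
    using sq_integrable_comb[OF GK] by simp
  fix \<psi> i assume \<psi>: "test_function \<Omega> \<psi>"
  note \<psi>2 = test_function_sq_integrable[OF \<Omega> \<psi>]
  have "l2_inner \<Omega> v (partial_deriv i \<psi>) = - l2_inner \<Omega> (\<lambda>x. G x $ i) \<psi>"
    "l2_inner \<Omega> w (partial_deriv i \<psi>) = - l2_inner \<Omega> (\<lambda>x. K x $ i) \<psi>"
    using v w \<psi> by (auto simp: has_weak_gradient_def l2_inner_def)
  then have "l2_inner \<Omega> (\<lambda>x. v x + t * w x) (partial_deriv i \<psi>)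
      = - l2_inner \<Omega> (\<lambda>x. G x $ i + t * K x $ i) \<psi>"
    using v w GK \<psi>2 by (simp add: l2_inner_comb_left)
  then show "(LINT x|lebesgue_on \<Omega>. (v x + t * w x) * partial_deriv i \<psi> x)
      = - (LINT x|lebesgue_on \<Omega>. (G x + t *\<^sub>R K x) $ i * \<psi> x)"
    by (simp add: l2_inner_def)
qed

text \<open>The difference of two weak gradients is orthogonal to all test functions.\<close>

lemma has_weak_gradient_unique:
  fixes \<Omega> :: "(real^'d) set"
  assumes \<Omega>: "open \<Omega>" "bounded \<Omega>"
    and G: "has_weak_gradient \<Omega> v G" and K: "has_weak_gradient \<Omega> v K"
  shows "AE x in lebesgue_on \<Omega>. G x = K x"
proof -
  have "AE x in lebesgue_on \<Omega>. G x $ i + (- 1) * K x $ i = 0" for i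
  proof (rule AE_0_of_test_functions[OF \<Omega>(1)])
    have GK: "sq_integrable \<Omega> (\<lambda>x. G x $ i)" "sq_integrable \<Omega> (\<lambda>x. K x $ i)"
      using G K by (auto simp: has_weak_gradient_def)
    have "sq_integrable \<Omega> (\<lambda>_. 1)"
      using \<Omega> by (intro sq_integrable_continuous) auto
    from sq_integrable_mult[OF sq_integrable_comb[OF GK, of "-1"] this]
    show "integrable (lebesgue_on \<Omega>) (\<lambda>x. G x $ i + (- 1) * K x $ i)"
      by simp
    fix \<psi> assume \<psi>: "test_function \<Omega> \<psi>"
    have "l2_inner \<Omega> (\<lambda>x. G x $ i) \<psi> = l2_inner \<Omega> (\<lambda>x. K x $ i) \<psi>"
      using G K \<psi> by (auto simp: has_weak_gradient_def l2_inner_def)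
    then show "(LINT x|lebesgue_on \<Omega>. (G x $ i + (- 1) * K x $ i) * \<psi> x) = 0"
      using l2_inner_comb_left[OF GK test_function_sq_integrable(1)[OF \<Omega> \<psi>], of "-1"]
      by (simp add: l2_inner_def)
  qed
  then have "AE x in lebesgue_on \<Omega>. \<forall>i. G x $ i + (- 1) * K x $ i = 0"
    by (subst AE_all_countable) auto
  then show ?thesis
    by eventually_elim (simp add: vec_eq_iff)
qed

lemma has_weak_gradient_weak_grad: "v \<in> H1 \<Omega> \<Longrightarrow> has_weak_gradient \<Omega> v (weak_grad \<Omega> v)"
  unfolding weak_grad_def H1_def by (auto intro: someI_ex[of "has_weak_gradient \<Omega> v"])

lemma H1_comb:
  assumes "open \<Omega>" "bounded \<Omega>" "v \<in> H1 \<Omega>" "w \<in> H1 \<Omega>"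
  shows "(\<lambda>x. v x + t * w x) \<in> H1 \<Omega>"
  using has_weak_gradient_comb[OF assms(1,2) _ _ _ _, of v _ w _ t] sq_integrable_comb[of \<Omega> v w t] assms(3,4)
  unfolding H1_def by blast

lemma H1_zero: "(\<lambda>_. 0) \<in> H1 \<Omega>"
  by (auto simp: H1_def has_weak_gradient_def sq_integrable_def intro!: exI[of _ "\<lambda>_. 0"])

lemma dform_integrable:
  assumes "v \<in> H1 \<Omega>" "w \<in> H1 \<Omega>"
  shows "integrable (lebesgue_on \<Omega>) (\<lambda>x. weak_grad \<Omega> v x \<bullet> weak_grad \<Omega> w x)"
  unfolding inner_vec_def
  using assms[THEN has_weak_gradient_weak_grad]
  by (auto simp: has_weak_gradient_def intro!: sq_integrable_mult Bochner_Integration.integrable_sum)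

lemma dform_commute: "dform \<Omega> a v w = dform \<Omega> a w v"
  by (simp add: dform_def inner_commute)

lemma dform_nonneg: "c \<ge> 0 \<Longrightarrow> dform \<Omega> (\<lambda>_. c) v v \<ge> 0"
  unfolding dform_def by (intro integral_nonneg_AE) auto

text \<open>The choice operator behind \<open>weak_grad\<close> need not pick gradients linearly. By uniqueness it does so
  outside a null set, which the integral does not see.\<close>

lemma dform_comb_left:
  assumes \<Omega>: "open \<Omega>" "bounded \<Omega>" and vwz: "v \<in> H1 \<Omega>" "w \<in> H1 \<Omega>" "z \<in> H1 \<Omega>"
  shows "dform \<Omega> (\<lambda>_. c) (\<lambda>x. v x + t * w x) z = dform \<Omega> (\<lambda>_. c) v z + t * dform \<Omega> (\<lambda>_. c) w z"
proof -
  let ?D = "weak_grad \<Omega>"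
  note comb = H1_comb[OF \<Omega> vwz(1,2), of t]
  have "has_weak_gradient \<Omega> (\<lambda>x. v x + t * w x) (\<lambda>x. ?D v x + t *\<^sub>R ?D w x)"
    using vwz by (intro has_weak_gradient_comb \<Omega> has_weak_gradient_weak_grad) (auto simp: H1_def)
  from has_weak_gradient_unique[OF \<Omega> has_weak_gradient_weak_grad[OF comb] this]
  have ae: "AE x in lebesgue_on \<Omega>. c * (?D (\<lambda>x. v x + t * w x) x \<bullet> ?D z x)
      = c * (?D v x \<bullet> ?D z x) + t * (c * (?D w x \<bullet> ?D z x))"
    by eventually_elim (simp add: inner_add_left algebra_simps)
  note int = dform_integrable[OF vwz(1,3)] dform_integrable[OF vwz(2,3)] dform_integrable[OF comb vwz(3)]
  have "dform \<Omega> (\<lambda>_. c) (\<lambda>x. v x + t * w x) z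
      = (LINT x|lebesgue_on \<Omega>. c * (?D v x \<bullet> ?D z x) + t * (c * (?D w x \<bullet> ?D z x)))"
    unfolding dform_def
    by (rule integral_cong_AE[OF _ _ ae])
       (use int in \<open>auto intro!: borel_measurable_add borel_measurable_times dest: borel_measurable_integrable\<close>)
  also have "\<dots> = dform \<Omega> (\<lambda>_. c) v z + t * dform \<Omega> (\<lambda>_. c) w z"
    using int unfolding dform_def by (subst Bochner_Integration.integral_add) auto
  finally show ?thesis .
qed

section \<open>Variational problems on finite-dimensional function spaces\<close>

text \<open>Existence for the symmetric positive definite variational problem \<open>a w z = L z\<close> on a subspace \<open>V\<close> of the
  span of finitely many functions \<open>b j\<close>. The \<open>b j\<close> need not belong to \<open>V\<close>, so piecewise polynomials can
  serve for the finite element space without a nodal basis. Induction on the index set: the members of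
  \<open>V\<close> that do without \<open>b j\<close> form a subspace \<open>W\<close> of codimension at most one, in which the problem is
  solvable by hypothesis; one Gram-Schmidt step then supplies the missing direction.\<close>

lemma riesz_finite_span:
  fixes V :: "('a \<Rightarrow> real) set" and b :: "'i \<Rightarrow> 'a \<Rightarrow> real"
    and a :: "('a \<Rightarrow> real) \<Rightarrow> ('a \<Rightarrow> real) \<Rightarrow> real"
  assumes "finite J"
    and "\<And>v. v \<in> V \<Longrightarrow> \<exists>c. v = (\<lambda>x. \<Sum>j\<in>J. c j * b j x)"
    and "(\<lambda>_. 0) \<in> V"
    and "\<And>v w t. v \<in> V \<Longrightarrow> w \<in> V \<Longrightarrow> (\<lambda>x. v x + t * w x) \<in> V"
    and "\<And>v w z t. v \<in> V \<Longrightarrow> w \<in> V \<Longrightarrow> z \<in> V \<Longrightarrow> a (\<lambda>x. v x + t * w x) z = a v z + t * a w z"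
    and "\<And>v w. v \<in> V \<Longrightarrow> w \<in> V \<Longrightarrow> a v w = a w v"
    and "\<And>v. v \<in> V \<Longrightarrow> v \<noteq> (\<lambda>_. 0) \<Longrightarrow> a v v > 0"
    and "\<And>v w t. v \<in> V \<Longrightarrow> w \<in> V \<Longrightarrow> L (\<lambda>x. v x + t * w x) = L v + t * L w"
  shows "\<exists>w\<in>V. \<forall>z\<in>V. a w z = L z"
  using assms
proof (induction J arbitrary: V L rule: finite_induct)
  case empty
  then have V: "V = {\<lambda>_. 0}" by fastforce
  have "L (\<lambda>_. 0) = 0" "a (\<lambda>_. 0) (\<lambda>_. 0) = 0"
    using empty.prems(7)[of "\<lambda>_. 0" "\<lambda>_. 0" 1] empty.prems(4)[of "\<lambda>_. 0" "\<lambda>_. 0" "\<lambda>_. 0" 1] V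
    by auto
  then show ?case using V by auto
next
  case (insert j J)
  note span = insert.prems(1) and zero = insert.prems(2) and comb = insert.prems(3)
    and lin = insert.prems(4) and sym = insert.prems(5) and pos = insert.prems(6) and L = insert.prems(7)
  define W where "W = {v\<in>V. \<exists>c. v = (\<lambda>x. \<Sum>j\<in>J. c j * b j x)}"
  have WV: "W \<subseteq> V" by (auto simp: W_def)
  have WI: "v \<in> W" if "v \<in> V" "v = (\<lambda>x. \<Sum>j\<in>J. c j * b j x)" for v c
    using that unfolding W_def by blast
  have Wzero: "(\<lambda>_. 0) \<in> W"
    using zero by (auto simp: W_def intro!: exI[of _ "\<lambda>_. 0"])
  have Wcomb: "(\<lambda>x. v x + t * w x) \<in> W" if vw: "v \<in> W" "w \<in> W" for v w t
  proof -
    from vw obtain c c' where "v = (\<lambda>x. \<Sum>j\<in>J. c j * b j x)" "w = (\<lambda>x. \<Sum>j\<in>J. c' j * b j x)"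
      by (auto simp: W_def)
    then have "(\<lambda>x. v x + t * w x) = (\<lambda>x. \<Sum>j\<in>J. (c j + t * c' j) * b j x)"
      by (simp add: sum.distrib sum_distrib_left algebra_simps)
    then show ?thesis
      using vw WV by (intro WI comb) auto
  qed
  have solve: "\<exists>w\<in>W. \<forall>z\<in>W. a w z = M z"
    if "\<And>v w t. v \<in> W \<Longrightarrow> w \<in> W \<Longrightarrow> M (\<lambda>x. v x + t * w x) = M v + t * M w" for M
  proof (rule insert.IH)
    show "\<exists>c. v = (\<lambda>x. \<Sum>j\<in>J. c j * b j x)" if "v \<in> W" for v
      using that unfolding W_def by blast
    show "a (\<lambda>x. v x + t * w x) z = a v z + t * a w z" if "v \<in> W" "w \<in> W" "z \<in> W" for v w z t
      using that WV lin[of v w z t] by blast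
    show "a v w = a w v" if "v \<in> W" "w \<in> W" for v w
      using that WV sym[of v w] by blast
    show "a v v > 0" if "v \<in> W" "v \<noteq> (\<lambda>_. 0)" for v
      using that WV pos[of v] by blast
  qed (fact Wzero Wcomb that)+
  show ?case
  proof (cases "W = V")
    case True
    with solve[of L] L show ?thesis by blast
  next
    case False
    with WV obtain e where e: "e \<in> V" "e \<notin> W" by auto
    have lin2: "a z (\<lambda>x. v x + t * w x) = a z v + t * a z w" if "v \<in> V" "w \<in> V" "z \<in> V" for v w z t
      using lin[OF that, of t] sym[OF comb[OF that(1,2)] that(3), of t] sym[OF that(1,3)] sym[OF that(2,3)]
      by simp
    \<comment> \<open>Subtracting the multiple of \<open>e\<close> with the same coefficient at \<open>b j\<close> leaves an element of \<open>W\<close>.\<close>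
    have split: "\<exists>t. (\<lambda>x. v x + (- t) * e x) \<in> W" if v: "v \<in> V" for v
    proof -
      from span[OF v] obtain c where c: "v = (\<lambda>x. \<Sum>j\<in>insert j J. c j * b j x)" by auto
      from span[OF e(1)] obtain c' where c': "e = (\<lambda>x. \<Sum>j\<in>insert j J. c' j * b j x)" by auto
      have "c' j \<noteq> 0"
        using e c' insert.hyps by (auto simp: W_def)
      then have "(\<lambda>x. v x + (- (c j / c' j)) * e x) = (\<lambda>x. \<Sum>i\<in>J. (c i - c j / c' j * c' i) * b i x)"
        using insert.hyps by (auto simp: c c' sum_subtractf sum_negf sum_distrib_left algebra_simps)
      then have "(\<lambda>x. v x + (- (c j / c' j)) * e x) \<in> W"
        by (rule WI[OF comb[OF v e(1)]])
      then show ?thesis by (rule exI)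
    qed
    obtain p where p: "p \<in> W" "\<And>z. z \<in> W \<Longrightarrow> a p z = a e z"
    proof -
      have "a e (\<lambda>x. v x + t * w x) = a e v + t * a e w" if "v \<in> W" "w \<in> W" for v w t
        using that WV e(1) lin2[of v w e t] by blast
      from solve[of "a e", OF this] that show thesis by blast
    qed
    \<comment> \<open>The part of \<open>e\<close> that is orthogonal to \<open>W\<close>.\<close>
    define n where "n = (\<lambda>x. e x + (-1) * p x)"
    have n: "n \<in> V" using comb[of e p "-1"] e p WV by (auto simp: n_def)
    have "n \<noteq> (\<lambda>_. 0)"
    proof
      assume "n = (\<lambda>_. 0)"
      then have "e = p" by (auto simp: n_def fun_eq_iff)
      with e p show False by simp
    qed
    then have npos: "a n n > 0" using pos n by blast
    have orth: "a n z = 0" if "z \<in> W" for z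
      using lin[of e p z "-1"] p that e WV by (auto simp: n_def)
    obtain q where q: "q \<in> W" "\<And>z. z \<in> W \<Longrightarrow> a q z = L z"
    proof -
      have "L (\<lambda>x. v x + t * w x) = L v + t * L w" if "v \<in> W" "w \<in> W" for v w t
        using that WV L[of v w t] by blast
      from solve[of L, OF this] that show thesis by blast
    qed
    define s where "s = (L n - a q n) / a n n"
    define w where "w = (\<lambda>x. q x + s * n x)"
    have "a w z = L z" if z: "z \<in> V" for z
    proof -
      from split[OF z] obtain t where t: "(\<lambda>x. z x + (- t) * e x) \<in> W" by blast
      define y where "y = (\<lambda>x. (z x + (- t) * e x) + t * p x)"
      have y: "y \<in> W" unfolding y_def using Wcomb[OF t p(1)] by simp
      have zy: "z = (\<lambda>x. y x + t * n x)" by (auto simp: y_def n_def algebra_simps)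
      have yV: "y \<in> V" "q \<in> V" using y q WV by auto
      have "a w z = a q z + s * a n z"
        unfolding w_def using lin[of q n z s] yV n z by simp
      also have "\<dots> = a q y + t * a q n + s * (a n y + t * a n n)"
        unfolding zy using lin2 yV n by simp
      also have "\<dots> = L y + t * L n"
        using orth[OF y] q(2)[OF y] npos by (simp add: s_def field_simps)
      also have "\<dots> = L z"
        unfolding zy using L[of y n t] yV n by simp
      finally show ?thesis .
    qed
    moreover have "w \<in> V" unfolding w_def using comb[of q n s] q n WV by auto
    ultimately show ?thesis by blast
  qed
qed

section \<open>Piecewise polynomials\<close>

lemma finite_bounded_exponents: "finite {\<alpha> :: 'd::finite \<Rightarrow> nat. (\<Sum>i\<in>UNIV. \<alpha> i) \<le> k}"
proof -
  have "\<alpha> i \<le> k" if "(\<Sum>i\<in>UNIV. \<alpha> i) \<le> k" for \<alpha> :: "'d \<Rightarrow> nat" and i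
    using member_le_sum[of i UNIV \<alpha>] that by simp
  then have "{\<alpha> :: 'd \<Rightarrow> nat. (\<Sum>i\<in>UNIV. \<alpha> i) \<le> k} \<subseteq> (\<Pi>\<^sub>E i\<in>UNIV. {..k})"
    by (auto simp: PiE_iff)
  then show ?thesis
    by (rule finite_subset) (auto intro: finite_PiE)
qed

lemma polys_zero: "(\<lambda>_. 0) \<in> polys k"
  by (auto simp: polys_def intro!: exI[of _ "\<lambda>_. 0"])

lemma polys_comb:
  assumes "p \<in> polys k" "q \<in> polys k"
  shows "(\<lambda>x. p x + t * q x) \<in> polys k"
proof -
  from assms obtain c d where
    "\<And>x. p x = (\<Sum>\<alpha> | (\<Sum>i\<in>UNIV. \<alpha> i) \<le> k. c \<alpha> * (\<Prod>i\<in>UNIV. (x $ i) ^ \<alpha> i))"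
    "\<And>x. q x = (\<Sum>\<alpha> | (\<Sum>i\<in>UNIV. \<alpha> i) \<le> k. d \<alpha> * (\<Prod>i\<in>UNIV. (x $ i) ^ \<alpha> i))"
    unfolding polys_def by blast
  then have "p x + t * q x
      = (\<Sum>\<alpha> | (\<Sum>i\<in>UNIV. \<alpha> i) \<le> k. (c \<alpha> + t * d \<alpha>) * (\<Prod>i\<in>UNIV. (x $ i) ^ \<alpha> i))" for x
    by (simp add: sum.distrib sum_distrib_left algebra_simps)
  then show ?thesis
    unfolding polys_def mem_Collect_eq by (intro exI[of _ "\<lambda>\<alpha>. c \<alpha> + t * d \<alpha>"] allI)
qed

text \<open>Elements share faces, so each point \<open>x\<close> is assigned to one element \<open>\<tau> x\<close> containing it; the monomials cut
  off to the fibres of \<open>\<tau>\<close> then span all piecewise polynomials. The spanning functions are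
  discontinuous, but what counts is that there are finitely many.\<close>

lemma piecewise_polys_finite_span:
  fixes \<T> :: "(real^'d) set set"
  assumes fin: "finite \<T>"
  shows "\<exists>(J :: ((real^'d) set \<times> ('d \<Rightarrow> nat)) set) b. finite J \<and>
    (\<forall>v. (\<forall>x. x \<notin> \<Union>\<T> \<longrightarrow> v x = 0) \<longrightarrow> (\<forall>T\<in>\<T>. \<exists>p\<in>polys k. \<forall>x\<in>T. v x = p x)
         \<longrightarrow> (\<exists>c. v = (\<lambda>x. \<Sum>j\<in>J. c j * b j x)))"
proof -
  define A where "A = {\<alpha> :: 'd \<Rightarrow> nat. (\<Sum>i\<in>UNIV. \<alpha> i) \<le> k}"
  define mono where "mono \<alpha> x = (\<Prod>i\<in>UNIV. (x $ i) ^ \<alpha> i)" for \<alpha> and x :: "real^'d"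
  define \<tau> where "\<tau> x = (SOME T. T \<in> \<T> \<and> x \<in> T)" for x
  define b where "b j x = (if x \<in> \<Union>\<T> \<and> \<tau> x = fst j then mono (snd j) x else 0)" for j x
  have \<tau>: "\<tau> x \<in> \<T>" "x \<in> \<tau> x" if "x \<in> \<Union>\<T>" for x
    using someI_ex[of "\<lambda>T. T \<in> \<T> \<and> x \<in> T"] that by (auto simp: \<tau>_def)
  have finA: "finite A" unfolding A_def by (rule finite_bounded_exponents)
  show ?thesis
  proof (intro exI[of _ "\<T> \<times> A"] exI[of _ b] conjI allI impI)
    show "finite (\<T> \<times> A)" using fin finA by simp
    fix v assume zero: "\<forall>x. x \<notin> \<Union>\<T> \<longrightarrow> v x = 0"
      and poly: "\<forall>T\<in>\<T>. \<exists>p\<in>polys k. \<forall>x\<in>T. v x = p x"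
    have "\<forall>T\<in>\<T>. \<exists>c. \<forall>x\<in>T. v x = (\<Sum>\<alpha>\<in>A. c \<alpha> * mono \<alpha> x)"
    proof
      fix T assume "T \<in> \<T>"
      with poly obtain p where p: "p \<in> polys k" "\<forall>x\<in>T. v x = p x" by blast
      from p(1) obtain c where "\<forall>x. p x = (\<Sum>\<alpha>\<in>A. c \<alpha> * mono \<alpha> x)"
        unfolding polys_def A_def mono_def by blast
      with p(2) show "\<exists>c. \<forall>x\<in>T. v x = (\<Sum>\<alpha>\<in>A. c \<alpha> * mono \<alpha> x)" by auto
    qed
    then obtain c where c: "\<And>T x. T \<in> \<T> \<Longrightarrow> x \<in> T \<Longrightarrow> v x = (\<Sum>\<alpha>\<in>A. c T \<alpha> * mono \<alpha> x)"
      by (metis bchoice)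
    have "v x = (\<Sum>j\<in>\<T> \<times> A. c (fst j) (snd j) * b j x)" for x
    proof (cases "x \<in> \<Union>\<T>")
      case True
      have "(\<Sum>j\<in>\<T> \<times> A. c (fst j) (snd j) * b j x)
          = (\<Sum>T\<in>\<T>. if T = \<tau> x then \<Sum>\<alpha>\<in>A. c T \<alpha> * mono \<alpha> x else 0)"
        unfolding sum.cartesian_product' using True by (intro sum.cong) (auto simp: b_def)
      also have "\<dots> = (\<Sum>\<alpha>\<in>A. c (\<tau> x) \<alpha> * mono \<alpha> x)"
        using fin \<tau>[OF True] by simp
      also have "\<dots> = v x"
        using c[OF \<tau>[OF True]] by simp
      finally show ?thesis by simp
    next
      case False
      then show ?thesis using zero by (auto simp: b_def)
    qed
    then show "\<exists>c. v = (\<lambda>x. \<Sum>j\<in>\<T> \<times> A. c j * b j x)"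
      by (intro exI[of _ "\<lambda>j. c (fst j) (snd j)"] ext)
  qed
qed

section \<open>The finite element space and its L2 projection\<close>

locale fe_mesh =
  fixes \<Omega> :: "(real^'d) set" and \<T> :: "(real^'d) set set" and k :: nat
  assumes open_domain: "open \<Omega>" and bounded_domain: "bounded \<Omega>"
    and finite_mesh: "finite \<T>" and Union_mesh: "\<Union>\<T> = closure \<Omega>"
begin

abbreviation Vh :: "(real^'d \<Rightarrow> real) set" where
  "Vh \<equiv> fe_space \<Omega> \<T> k"

lemma Vh_C0: "v \<in> Vh \<Longrightarrow> v \<in> C0 \<Omega>" and Vh_H1: "v \<in> Vh \<Longrightarrow> v \<in> H1 \<Omega>"
  by (auto simp: fe_space_def)

lemma Vh_sq_integrable: "v \<in> Vh \<Longrightarrow> sq_integrable \<Omega> v"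
  by (intro C0_sq_integrable open_domain bounded_domain Vh_C0)

lemma Vh_zero: "(\<lambda>_. 0) \<in> Vh"
  using polys_zero H1_zero by (auto simp: fe_space_def C0_def intro!: bexI[of _ "\<lambda>_. 0"])

lemma Vh_comb:
  assumes vw: "v \<in> Vh" "w \<in> Vh"
  shows "(\<lambda>x. v x + t * w x) \<in> Vh"
  unfolding fe_space_def
proof (intro CollectI conjI IntI ballI)
  show "(\<lambda>x. v x + t * w x) \<in> C0 \<Omega>"
    by (intro C0_comb Vh_C0 vw)
  show "(\<lambda>x. v x + t * w x) \<in> H1 \<Omega>"
    by (intro H1_comb Vh_H1 vw open_domain bounded_domain)
  fix T assume "T \<in> \<T>"
  with vw obtain p q where "p \<in> polys k" "\<forall>x\<in>T. v x = p x" "q \<in> polys k" "\<forall>x\<in>T. w x = q x"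
    unfolding fe_space_def by blast
  then show "\<exists>p\<in>polys k. \<forall>x\<in>T. v x + t * w x = p x"
    by (intro bexI[OF _ polys_comb[of p k q t]]) auto
qed

lemma Vh_diff: "v \<in> Vh \<Longrightarrow> w \<in> Vh \<Longrightarrow> (\<lambda>x. v x - w x) \<in> Vh"
  using Vh_comb[of v w "-1"] by simp

lemma Vh_riesz:
  assumes lin: "\<And>v w z t. v \<in> Vh \<Longrightarrow> w \<in> Vh \<Longrightarrow> z \<in> Vh \<Longrightarrow>
      a (\<lambda>x. v x + t * w x) z = a v z + t * a w z"
    and sym: "\<And>v w. v \<in> Vh \<Longrightarrow> w \<in> Vh \<Longrightarrow> a v w = a w v"
    and pos: "\<And>v. v \<in> Vh \<Longrightarrow> v \<noteq> (\<lambda>_. 0) \<Longrightarrow> a v v > 0"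
    and L: "\<And>v w t. v \<in> Vh \<Longrightarrow> w \<in> Vh \<Longrightarrow> L (\<lambda>x. v x + t * w x) = L v + t * L w"
  shows "\<exists>!w. w \<in> Vh \<and> (\<forall>z\<in>Vh. a w z = (L z :: real))"
proof -
  obtain J :: "((real^'d) set \<times> ('d \<Rightarrow> nat)) set" and b where J: "finite J"
    and b: "\<forall>v. (\<forall>x. x \<notin> \<Union>\<T> \<longrightarrow> v x = 0) \<longrightarrow> (\<forall>T\<in>\<T>. \<exists>p\<in>polys k. \<forall>x\<in>T. v x = p x)
           \<longrightarrow> (\<exists>c. v = (\<lambda>x. \<Sum>j\<in>J. c j * b j x))"
    using piecewise_polys_finite_span[OF finite_mesh, where k = k] by (elim exE conjE)
  have span: "\<exists>c. v = (\<lambda>x. \<Sum>j\<in>J. c j * b j x)" if "v \<in> Vh" for v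
  proof (rule b[rule_format])
    show "v x = 0" if "x \<notin> \<Union>\<T>" for x
      using that \<open>v \<in> Vh\<close> by (simp add: fe_space_def C0_def Union_mesh)
    show "\<exists>p\<in>polys k. \<forall>x\<in>T. v x = p x" if "T \<in> \<T>" for T
      using that \<open>v \<in> Vh\<close> by (simp add: fe_space_def)
  qed
  have "\<exists>w\<in>Vh. \<forall>z\<in>Vh. a w z = L z"
    by (rule riesz_finite_span[where J = J and b = b]) (fact J span Vh_zero Vh_comb lin sym pos L)+
  then obtain w where w: "w \<in> Vh" "\<forall>z\<in>Vh. a w z = L z" by blast
  show ?thesis
  proof (intro ex1I conjI)
    show "w \<in> Vh" "\<forall>z\<in>Vh. a w z = L z" by fact+
    fix y assume y: "y \<in> Vh \<and> (\<forall>z\<in>Vh. a y z = L z)"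
    define e where "e = (\<lambda>x. y x + (-1) * w x)"
    have e: "e \<in> Vh" unfolding e_def using y w by (intro Vh_comb) auto
    have "a e e = a y e + (-1) * a w e"
      using lin[of y w e "-1"] y w e by (simp add: e_def)
    also have "\<dots> = 0" using y w e by simp
    finally have "e = (\<lambda>_. 0)" using pos[OF e] by force
    then show "y = w" by (simp add: e_def fun_eq_iff)
  qed
qed

text \<open>The projection is the Riesz representative of \<open>f\<close> with respect to the \<open>L\<^sup>2\<close> product on \<open>V\<^sub>h\<close>; this is
  what gives the definite description in \<open>l2_proj\<close> a meaning.\<close>

lemma l2_proj:
  assumes f: "sq_integrable \<Omega> f"
  shows l2_proj_in: "l2_proj \<Omega> Vh f \<in> Vh"
    and l2_proj_orth: "\<And>z. z \<in> Vh \<Longrightarrow> l2_inner \<Omega> (\<lambda>x. f x - l2_proj \<Omega> Vh f x) z = 0"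
proof -
  have orth_iff: "l2_inner \<Omega> (\<lambda>x. f x - p x) z = 0 \<longleftrightarrow> l2_inner \<Omega> p z = l2_inner \<Omega> f z"
    if "p \<in> Vh" "z \<in> Vh" for p z
    using l2_inner_comb_left[OF f that[THEN Vh_sq_integrable], of "-1"] by auto
  have "\<exists>!p. p \<in> Vh \<and> (\<forall>z\<in>Vh. l2_inner \<Omega> p z = l2_inner \<Omega> f z)"
    by (rule Vh_riesz)
       (auto intro!: l2_inner_comb_left l2_inner_comb_right l2_inner_pos
          intro: Vh_sq_integrable Vh_C0 l2_inner_commute f open_domain bounded_domain)
  also have "(\<lambda>p. p \<in> Vh \<and> (\<forall>z\<in>Vh. l2_inner \<Omega> p z = l2_inner \<Omega> f z))
      = (\<lambda>p. p \<in> Vh \<and> (\<forall>z\<in>Vh. l2_inner \<Omega> (\<lambda>x. f x - p x) z = 0))"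
    by (rule ext) (use orth_iff in blast)
  finally have "\<exists>!p. p \<in> Vh \<and> (\<forall>z\<in>Vh. l2_inner \<Omega> (\<lambda>x. f x - p x) z = 0)" .
  from theI'[OF this]
  show "l2_proj \<Omega> Vh f \<in> Vh" "\<And>z. z \<in> Vh \<Longrightarrow> l2_inner \<Omega> (\<lambda>x. f x - l2_proj \<Omega> Vh f x) z = 0"
    unfolding l2_proj_def by blast+
qed

lemma l2_proj_contraction:
  assumes f: "sq_integrable \<Omega> f"
  shows "l2_inner \<Omega> (l2_proj \<Omega> Vh f) (l2_proj \<Omega> Vh f) \<le> l2_inner \<Omega> f f"
proof -
  define p where "p = l2_proj \<Omega> Vh f"
  define r where "r = (\<lambda>x. f x - p x)"
  have p: "p \<in> Vh" "sq_integrable \<Omega> p"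
    using l2_proj_in[OF f] Vh_sq_integrable by (auto simp: p_def)
  have r: "sq_integrable \<Omega> r"
    using sq_integrable_comb[OF f p(2), of "-1"] by (simp add: r_def)
  have rp: "l2_inner \<Omega> r p = 0"
    using l2_proj_orth[OF f p(1)] by (simp add: r_def p_def)
  have f_eq: "f = (\<lambda>x. r x + 1 * p x)" by (simp add: r_def)
  have "l2_inner \<Omega> f f = l2_inner \<Omega> r f + l2_inner \<Omega> p f"
    using l2_inner_comb_left[OF r p(2) f, of 1] f_eq by simp
  also have "\<dots> = l2_inner \<Omega> r r + l2_inner \<Omega> p p"
    using l2_inner_comb_right[OF r p(2) r, of 1] l2_inner_comb_right[OF r p(2) p(2), of 1] f_eq rp
    by (simp add: l2_inner_commute)
  finally show ?thesis
    using l2_inner_nonneg[of \<Omega> r] by (simp add: p_def)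
qed

end


section \<open>One step of the scheme\<close>

text \<open>One time step with an arbitrary nonlinearity: what matters is that \<open>H(u)\<close> is continuous up to the
  boundary, so that multiplication by it preserves \<open>C0 \<Omega>\<close>.\<close>

locale linear_scheme = fe_mesh \<Omega> \<T> k
  for \<Omega> :: "(real^'d) set" and \<T> k +
  fixes \<epsilon> \<Delta>t :: real and H :: "real \<Rightarrow> real" and u U :: "real^'d \<Rightarrow> real"
  assumes dt_pos: "\<Delta>t > 0" and u: "u \<in> Vh" and U: "U \<in> C0 \<Omega>"
    and H_cont: "continuous_on (closure \<Omega>) (\<lambda>x. H (u x))"
begin

definition P :: "real^'d \<Rightarrow> real" where "P = l2_proj \<Omega> Vh U"

definition h :: "real^'d \<Rightarrow> real" where "h x = H (u x)"

abbreviation dir :: "(real^'d \<Rightarrow> real) \<Rightarrow> (real^'d \<Rightarrow> real) \<Rightarrow> real" where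
  "dir \<equiv> dform \<Omega> (\<lambda>_. \<epsilon>\<^sup>2)"

text \<open>The variational problem for the increment \<open>u' - u\<close> after the elimination of \<open>U'\<close>. Writing the last term
  with one factor \<open>h\<close> on each side makes symmetry and nonnegativity evident.\<close>

definition incr_form :: "(real^'d \<Rightarrow> real) \<Rightarrow> (real^'d \<Rightarrow> real) \<Rightarrow> real" where
  "incr_form v z = l2_inner \<Omega> v z / \<Delta>t + dir v z + 1/2 * l2_inner \<Omega> (\<lambda>x. h x * v x) (\<lambda>x. h x * z x)"

definition incr_rhs :: "(real^'d \<Rightarrow> real) \<Rightarrow> real" where
  "incr_rhs z = - dir u z - l2_inner \<Omega> (\<lambda>x. h x * P x) z"

lemma C0_sq: "v \<in> C0 \<Omega> \<Longrightarrow> sq_integrable \<Omega> v"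
  by (intro C0_sq_integrable open_domain bounded_domain)

lemma P_Vh: "P \<in> Vh"
  unfolding P_def by (intro l2_proj_in C0_sq U)

lemma C0_h_mult: "v \<in> C0 \<Omega> \<Longrightarrow> (\<lambda>x. h x * v x) \<in> C0 \<Omega>"
  using H_cont by (auto simp: C0_def h_def intro!: continuous_intros)

lemma h_sq: "v \<in> Vh \<Longrightarrow> sq_integrable \<Omega> (\<lambda>x. h x * v x)"
  by (intro C0_sq C0_h_mult Vh_C0)

lemma dir_comb_left:
  "\<lbrakk>v \<in> Vh; w \<in> Vh; z \<in> Vh\<rbrakk> \<Longrightarrow> dir (\<lambda>x. v x + t * w x) z = dir v z + t * dir w z"
  by (intro dform_comb_left open_domain bounded_domain Vh_H1)

lemma incr_form_comb_left:
  assumes "v \<in> Vh" "w \<in> Vh" "z \<in> Vh"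
  shows "incr_form (\<lambda>x. v x + t * w x) z = incr_form v z + t * incr_form w z"
proof -
  have "(\<lambda>x. h x * (v x + t * w x)) = (\<lambda>x. h x * v x + t * (h x * w x))"
    by (simp add: algebra_simps)
  then show ?thesis
    using l2_inner_comb_left[OF assms[THEN Vh_sq_integrable], of t]
      l2_inner_comb_left[OF assms[THEN h_sq], of t] dir_comb_left[OF assms, of t]
    by (simp add: incr_form_def add_divide_distrib algebra_simps)
qed

lemma incr_form_commute: "incr_form v w = incr_form w v"
  unfolding incr_form_def by (simp add: l2_inner_commute[of \<Omega> v] dform_commute[of \<Omega> _ v] l2_inner_commute[of \<Omega> "\<lambda>x. h x * v x"])

lemma incr_form_pos:
  assumes "v \<in> Vh" "v \<noteq> (\<lambda>_. 0)"
  shows "incr_form v v > 0"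
proof -
  have "l2_inner \<Omega> v v / \<Delta>t > 0"
    using assms dt_pos by (intro divide_pos_pos l2_inner_pos open_domain bounded_domain Vh_C0)
  then show ?thesis
    unfolding incr_form_def
    using dform_nonneg[of "\<epsilon>\<^sup>2" \<Omega> v] l2_inner_nonneg[of \<Omega> "\<lambda>x. h x * v x"] by simp
qed

lemma incr_rhs_comb:
  assumes "v \<in> Vh" "w \<in> Vh"
  shows "incr_rhs (\<lambda>x. v x + t * w x) = incr_rhs v + t * incr_rhs w"
proof -
  have "dir u (\<lambda>x. v x + t * w x) = dir u v + t * dir u w"
    using dir_comb_left[OF assms u, of t] by (simp add: dform_commute)
  moreover have "l2_inner \<Omega> (\<lambda>x. h x * P x) (\<lambda>x. v x + t * w x)
      = l2_inner \<Omega> (\<lambda>x. h x * P x) v + t * l2_inner \<Omega> (\<lambda>x. h x * P x) w"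
    by (intro l2_inner_comb_right Vh_sq_integrable assms h_sq P_Vh)
  ultimately show ?thesis
    by (simp add: incr_rhs_def algebra_simps)
qed

lemma incr_unique_solution: "\<exists>!d. d \<in> Vh \<and> (\<forall>z\<in>Vh. incr_form d z = incr_rhs z)"
  by (intro Vh_riesz incr_form_comb_left incr_form_commute incr_form_pos incr_rhs_comb)

lemma auxiliary_C0: "v \<in> Vh \<Longrightarrow> (\<lambda>x. P x + 1/2 * (h x * (v x - u x))) \<in> C0 \<Omega>"
  by (intro C0_comb C0_h_mult Vh_C0 Vh_diff P_Vh u)

text \<open>The pointwise relation is only imposed on the closure of \<open>\<Omega>\<close>. Outside, all functions involved vanish,
  which makes it an equation between functions and so determines \<open>U'\<close>.\<close>

lemma auxiliary_update_iff:
  assumes "u' \<in> Vh" "U' \<in> C0 \<Omega>"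
  shows "(\<forall>x\<in>closure \<Omega>. (U' x - P x) / \<Delta>t = 1/2 * H (u x) * ((u' x - u x) / \<Delta>t))
     \<longleftrightarrow> U' = (\<lambda>x. P x + 1/2 * (h x * (u' x - u x)))" (is "?L \<longleftrightarrow> ?R")
proof -
  have "U' x = P x + 1/2 * (h x * (u' x - u x))" if "x \<notin> closure \<Omega>" for x
    using that assms(2) auxiliary_C0[OF assms(1)] by (simp add: C0_def)
  moreover have "(U' x - P x) / \<Delta>t = 1/2 * H (u x) * ((u' x - u x) / \<Delta>t)
      \<longleftrightarrow> U' x = P x + 1/2 * (h x * (u' x - u x))" for x
  proof -
    have "1/2 * H (u x) * ((u' x - u x) / \<Delta>t) = (1/2 * (h x * (u' x - u x))) / \<Delta>t"
      by (simp add: h_def)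
    then show ?thesis
      using dt_pos by (simp only: divide_cancel_right) auto
  qed
  ultimately show ?thesis by (auto simp: fun_eq_iff)
qed

lemma momentum_iff:
  assumes u': "u' \<in> Vh" and z: "z \<in> Vh"
  defines "d \<equiv> \<lambda>x. u' x - u x" and "U' \<equiv> \<lambda>x. P x + 1/2 * (h x * (u' x - u x))"
  shows "l2_inner \<Omega> (\<lambda>x. (u' x - u x) / \<Delta>t) z = - dir u' z - l2_inner \<Omega> (\<lambda>x. H (u x) * U' x) z
     \<longleftrightarrow> incr_form d z = incr_rhs z"
proof -
  have d: "d \<in> Vh" unfolding d_def by (intro Vh_diff u' u)
  have "u' = (\<lambda>x. u x + 1 * d x)" by (simp add: d_def)
  then have "dir u' z = dir u z + dir d z"
    using dir_comb_left[OF u d z, of 1] by simp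
  moreover have "l2_inner \<Omega> (\<lambda>x. (u' x - u x) / \<Delta>t) z = l2_inner \<Omega> d z / \<Delta>t"
    by (simp add: l2_inner_def d_def)
  moreover have "l2_inner \<Omega> (\<lambda>x. H (u x) * U' x) z
      = l2_inner \<Omega> (\<lambda>x. h x * P x) z + 1/2 * l2_inner \<Omega> (\<lambda>x. h x * d x) (\<lambda>x. h x * z x)"
  proof -
    have "(\<lambda>x. H (u x) * U' x) = (\<lambda>x. h x * P x + 1/2 * (h x * (h x * d x)))"
      by (simp add: U'_def d_def h_def algebra_simps)
    then have "l2_inner \<Omega> (\<lambda>x. H (u x) * U' x) z
        = l2_inner \<Omega> (\<lambda>x. h x * P x) z + 1/2 * l2_inner \<Omega> (\<lambda>x. h x * (h x * d x)) z"
      using l2_inner_comb_left[of \<Omega> "\<lambda>x. h x * P x" "\<lambda>x. h x * (h x * d x)" z "1/2"]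
        h_sq[OF P_Vh] C0_sq[OF C0_h_mult[OF C0_h_mult[OF Vh_C0[OF d]]]] Vh_sq_integrable[OF z] by simp
    also have "l2_inner \<Omega> (\<lambda>x. h x * (h x * d x)) z = l2_inner \<Omega> (\<lambda>x. h x * d x) (\<lambda>x. h x * z x)"
      by (simp add: l2_inner_def mult_ac)
    finally show ?thesis .
  qed
  ultimately show ?thesis
    unfolding incr_form_def incr_rhs_def by auto
qed

lemma scheme_step_iff:
  "scheme_step \<Omega> Vh \<epsilon> H \<Delta>t u U u' U' \<longleftrightarrow>
     u' \<in> Vh \<and> U' = (\<lambda>x. P x + 1/2 * (h x * (u' x - u x))) \<and>
     (\<forall>z\<in>Vh. incr_form (\<lambda>x. u' x - u x) z = incr_rhs z)"
proof
  assume step: "scheme_step \<Omega> Vh \<epsilon> H \<Delta>t u U u' U'"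
  have u': "u' \<in> Vh" and U': "U' \<in> C0 \<Omega>"
    and aux: "\<forall>x\<in>closure \<Omega>. (U' x - P x) / \<Delta>t = 1/2 * H (u x) * ((u' x - u x) / \<Delta>t)"
    using step unfolding scheme_step_def P_def[symmetric] by - (elim conjE, assumption)+
  have U'_eq: "U' = (\<lambda>x. P x + 1/2 * (h x * (u' x - u x)))"
    using aux by (simp only: auxiliary_update_iff[OF u' U'])
  have "incr_form (\<lambda>x. u' x - u x) z = incr_rhs z" if z: "z \<in> Vh" for z
  proof -
    have "l2_inner \<Omega> (\<lambda>x. (u' x - u x) / \<Delta>t) z = - dir u' z - l2_inner \<Omega> (\<lambda>x. H (u x) * U' x) z"
      using step z by (simp only: scheme_step_def)
    then show ?thesis
      unfolding U'_eq by (simp only: momentum_iff[OF u' z])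
  qed
  with u' U'_eq show "u' \<in> Vh \<and> U' = (\<lambda>x. P x + 1/2 * (h x * (u' x - u x))) \<and>
     (\<forall>z\<in>Vh. incr_form (\<lambda>x. u' x - u x) z = incr_rhs z)" by (intro conjI ballI)
next
  assume "u' \<in> Vh \<and> U' = (\<lambda>x. P x + 1/2 * (h x * (u' x - u x))) \<and>
     (\<forall>z\<in>Vh. incr_form (\<lambda>x. u' x - u x) z = incr_rhs z)"
  then have u': "u' \<in> Vh" and U'_eq: "U' = (\<lambda>x. P x + 1/2 * (h x * (u' x - u x)))"
    and incr: "\<forall>z\<in>Vh. incr_form (\<lambda>x. u' x - u x) z = incr_rhs z"
    by - (elim conjE, assumption)+
  have U': "U' \<in> C0 \<Omega>" unfolding U'_eq by (rule auxiliary_C0[OF u'])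
  have "\<forall>x\<in>closure \<Omega>. (U' x - P x) / \<Delta>t = 1/2 * H (u x) * ((u' x - u x) / \<Delta>t)"
    unfolding auxiliary_update_iff[OF u' U'] by (rule U'_eq)
  moreover have "l2_inner \<Omega> (\<lambda>x. (u' x - u x) / \<Delta>t) z = - dir u' z - l2_inner \<Omega> (\<lambda>x. H (u x) * U' x) z"
    if "z \<in> Vh" for z
    unfolding U'_eq momentum_iff[OF u' that] using incr that by (rule bspec)
  ultimately show "scheme_step \<Omega> Vh \<epsilon> H \<Delta>t u U u' U'"
    unfolding scheme_step_def P_def[symmetric] using u' U' by (intro conjI ballI) simp_all
qed

lemma scheme_step_unique_solution: "\<exists>!p. scheme_step \<Omega> Vh \<epsilon> H \<Delta>t u U (fst p) (snd p)"
proof -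
  obtain d where d: "d \<in> Vh" "\<forall>z\<in>Vh. incr_form d z = incr_rhs z"
    and unique: "\<And>e. e \<in> Vh \<Longrightarrow> \<forall>z\<in>Vh. incr_form e z = incr_rhs z \<Longrightarrow> e = d"
    using incr_unique_solution by blast
  define u' where "u' = (\<lambda>x. u x + 1 * d x)"
  have u': "u' \<in> Vh" unfolding u'_def by (intro Vh_comb u d)
  have du: "(\<lambda>x. u' x - u x) = d" by (simp add: u'_def)
  show ?thesis
  proof (rule ex1I[of _ "(u', \<lambda>x. P x + 1/2 * (h x * (u' x - u x)))"])
    show "scheme_step \<Omega> Vh \<epsilon> H \<Delta>t u U (fst (u', \<lambda>x. P x + 1/2 * (h x * (u' x - u x))))
        (snd (u', \<lambda>x. P x + 1/2 * (h x * (u' x - u x))))"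
      unfolding scheme_step_iff fst_conv snd_conv du using u' d by blast
    fix q assume "scheme_step \<Omega> Vh \<epsilon> H \<Delta>t u U (fst q) (snd q)"
    then have q: "fst q \<in> Vh" "snd q = (\<lambda>x. P x + 1/2 * (h x * (fst q x - u x)))"
      "\<forall>z\<in>Vh. incr_form (\<lambda>x. fst q x - u x) z = incr_rhs z"
      unfolding scheme_step_iff by blast+
    have "(\<lambda>x. fst q x - u x) = d"
      by (intro unique Vh_diff q u)
    then have "fst q x - u x = d x" for x by (rule fun_cong)
    then have "fst q = u'"
      by (simp add: u'_def fun_eq_iff diff_eq_eq add.commute)
    with q(2) show "q = (u', \<lambda>x. P x + 1/2 * (h x * (u' x - u x)))"
      by (simp add: prod_eq_iff)
  qed
qed

text \<open>The first equation is tested with the increment \<open>d\<close>; \<open>r = U' - \<Pi> U\<close> satisfies \<open>2 r = H(u) d\<close>, which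
  converts the coupling term into \<open>2 (U', r)\<close>.\<close>

lemma energy_law:
  assumes step: "scheme_step \<Omega> Vh \<epsilon> H \<Delta>t u U u' U'"
  shows "energy \<Omega> \<epsilon> B u' U' = energy \<Omega> \<epsilon> B u P
         - 1 / \<Delta>t * (l2_norm \<Omega> (\<lambda>x. u' x - u x))\<^sup>2
         - 1/2 * dir (\<lambda>x. u' x - u x) (\<lambda>x. u' x - u x)
         - (l2_norm \<Omega> (\<lambda>x. U' x - P x))\<^sup>2"
proof -
  define d where "d = (\<lambda>x. u' x - u x)"
  define r where "r = (\<lambda>x. U' x - P x)"
  have u': "u' \<in> Vh" and U': "U' \<in> C0 \<Omega>"
    using step by (simp_all only: scheme_step_def)
  have d: "d \<in> Vh" unfolding d_def by (intro Vh_diff u' u)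
  have r: "2 * r x = h x * d x" for x
  proof -
    from step have "U' = (\<lambda>x. P x + 1/2 * (h x * d x))"
      by (simp only: scheme_step_iff d_def)
    from fun_cong[OF this, of x] show ?thesis by (simp add: r_def)
  qed
  have U'sq: "sq_integrable \<Omega> U'" and Psq: "sq_integrable \<Omega> P"
    by (intro C0_sq U' Vh_C0[OF P_Vh])+
  have rsq: "sq_integrable \<Omega> r"
    using sq_integrable_comb[OF U'sq Psq, of "-1"] by (simp add: r_def)
  have "l2_inner \<Omega> (\<lambda>x. d x / \<Delta>t) d = - dir u' d - l2_inner \<Omega> (\<lambda>x. H (u x) * U' x) d"
    using step d by (simp only: scheme_step_def d_def)
  moreover have "l2_inner \<Omega> (\<lambda>x. d x / \<Delta>t) d = l2_inner \<Omega> d d / \<Delta>t"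
    by (simp add: l2_inner_def)
  moreover have "l2_inner \<Omega> (\<lambda>x. H (u x) * U' x) d = 2 * l2_inner \<Omega> U' r"
  proof -
    have "(\<lambda>x. H (u x) * U' x * d x) = (\<lambda>x. 2 * (U' x * r x))"
    proof
      fix x
      have "H (u x) * U' x * d x = U' x * (h x * d x)" by (simp add: h_def)
      also have "\<dots> = 2 * (U' x * r x)" unfolding r[symmetric] by simp
      finally show "H (u x) * U' x * d x = 2 * (U' x * r x)" .
    qed
    then show ?thesis unfolding l2_inner_def by simp
  qed
  ultimately have tested: "l2_inner \<Omega> d d / \<Delta>t = - dir u' d - 2 * l2_inner \<Omega> U' r"
    by simp
  have "P = (\<lambda>x. U' x + (-1) * r x)" by (simp add: r_def)
  \<comment> \<open>Expanding the quadratic forms at \<open>P = U' - r\<close> and, below, at \<open>u = u' - d\<close> gives the polarisation identities.\<close>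
  then have PP: "l2_inner \<Omega> P P = l2_inner \<Omega> U' U' - 2 * l2_inner \<Omega> U' r + l2_inner \<Omega> r r"
    using l2_inner_comb_left[OF U'sq rsq Psq, of "-1"] l2_inner_comb_right[OF U'sq rsq U'sq, of "-1"]
      l2_inner_comb_right[OF U'sq rsq rsq, of "-1"] l2_inner_commute[of \<Omega> U' r] by simp
  have "u = (\<lambda>x. u' x + (-1) * d x)" by (simp add: d_def)
  then have uu: "dir u u = dir u' u' - 2 * dir u' d + dir d d"
    using dir_comb_left[OF u' d u, of "-1"] dir_comb_left[OF u' d u', of "-1"]
      dir_comb_left[OF u' d d, of "-1"] dform_commute[of \<Omega> "\<lambda>_. \<epsilon>\<^sup>2" u' u]
      dform_commute[of \<Omega> "\<lambda>_. \<epsilon>\<^sup>2" u' d] dform_commute[of \<Omega> "\<lambda>_. \<epsilon>\<^sup>2" d u] by simp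
  have energy_eq: "energy \<Omega> \<epsilon> B v V = 1/2 * dir v v + l2_inner \<Omega> V V - B * measure lebesgue \<Omega>" for v V
    by (simp add: energy_def l2_inner_def power2_eq_square)
  have "1 / \<Delta>t * l2_inner \<Omega> d d = - dir u' d - 2 * l2_inner \<Omega> U' r"
    using tested by simp
  with energy_eq[of u' U'] energy_eq[of u P] PP uu show ?thesis
    unfolding l2_norm_power2 d_def[symmetric] r_def[symmetric] by linarith
qed

lemma energy_l2_proj_le:
  assumes "V \<in> C0 \<Omega>"
  shows "energy \<Omega> \<epsilon> B v (l2_proj \<Omega> Vh V) \<le> energy \<Omega> \<epsilon> B v V"
  using l2_proj_contraction[OF C0_sq[OF assms]]
  by (simp add: energy_def l2_inner_def power2_eq_square)

end

section \<open>Unique solvability and energy dissipation\<close>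

lemma continuous_on_Hfun:
  assumes "\<And>w. w \<in> I \<Longrightarrow> (F has_real_derivative F' w) (at w within I)" "continuous_on I F'"
    and "continuous_on S u" "\<And>x. x \<in> S \<Longrightarrow> u x \<in> I \<and> F (u x) + B > 0"
  shows "continuous_on S (\<lambda>x. Hfun F F' B (u x))"
proof -
  have "continuous_on I F"
    unfolding continuous_on_eq_continuous_within using DERIV_continuous[OF assms(1)] by blast
  moreover have "u ` S \<subseteq> I" using assms(4) by auto
  ultimately have "continuous_on S (\<lambda>x. F (u x))" "continuous_on S (\<lambda>x. F' (u x))"
    using continuous_on_compose2[OF _ assms(3)] assms(2) by blast+
  moreover have "sqrt (F (u x) + B) \<noteq> 0" if "x \<in> S" for x
    using assms(4)[OF that] by simp
  ultimately show ?thesis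
    unfolding Hfun_def by (intro continuous_intros) auto
qed

theorem theorem3p2:
  fixes \<Omega> :: "(real^'d) set" and \<T> :: "(real^'d) set set"
    and k :: nat and \<sigma> \<epsilon> B \<Delta>t :: real
    and I :: "real set" and F F' :: "real \<Rightarrow> real"
    and u U :: "real^'d \<Rightarrow> real"
  defines "Vh \<equiv> fe_space \<Omega> \<T> k"
    and "H \<equiv> Hfun F F' B"
    and "E \<equiv> energy \<Omega> \<epsilon> B"
  assumes dim: "CARD('d) = 2 \<or> CARD('d) = 3"
    and domain: "open \<Omega>" "connected \<Omega>" "bounded \<Omega>" "\<Omega> \<noteq> {}"
    and mesh: "mesh_of \<Omega> \<T>" "quasi_uniform \<sigma> \<T>"
    and k: "k \<ge> 1"
    and eps: "\<epsilon> > 0"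
    and F_C1: "is_interval I" "\<And>w. w \<in> I \<Longrightarrow> (F has_real_derivative F' w) (at w within I)"
      "continuous_on I F'"
    and B: "B \<ge> 0"
    and dt: "\<Delta>t > 0"
    and u: "u \<in> Vh"
    and u_range: "\<And>x. x \<in> closure \<Omega> \<Longrightarrow> u x \<in> I \<and> F (u x) + B > 0"
    and U: "U \<in> C0 \<Omega>"
  shows "(\<exists>!p. scheme_step \<Omega> Vh \<epsilon> H \<Delta>t u U (fst p) (snd p)) \<and>
    (\<forall>u' U'. scheme_step \<Omega> Vh \<epsilon> H \<Delta>t u U u' U' \<longrightarrow>
       E u' (l2_proj \<Omega> Vh U') \<le> E u' U' \<and>
       E u' U' = E u (l2_proj \<Omega> Vh U)
         - 1 / \<Delta>t * (l2_norm \<Omega> (\<lambda>x. u' x - u x))\<^sup>2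
         - 1/2 * dform \<Omega> (\<lambda>_. \<epsilon>\<^sup>2) (\<lambda>x. u' x - u x) (\<lambda>x. u' x - u x)
         - (l2_norm \<Omega> (\<lambda>x. U' x - l2_proj \<Omega> Vh U x))\<^sup>2)"
proof -
  have "continuous_on (closure \<Omega>) u"
    using u by (simp add: Vh_def fe_space_def C0_def)
  then have "continuous_on (closure \<Omega>) (\<lambda>x. H (u x))"
    unfolding H_def by (intro continuous_on_Hfun[where I = I] F_C1 u_range)
  then interpret linear_scheme \<Omega> \<T> k \<epsilon> \<Delta>t H u U
    using domain mesh dt u U
    by unfold_locales (simp_all add: mesh_of_def triangulation_def Vh_def)
  show ?thesis
    unfolding Vh_def E_def P_def[symmetric]
  proof (intro conjI allI impI)
    show "\<exists>!p. scheme_step \<Omega> (fe_space \<Omega> \<T> k) \<epsilon> H \<Delta>t u U (fst p) (snd p)"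
      by (rule scheme_step_unique_solution)
    fix u' U' assume step: "scheme_step \<Omega> (fe_space \<Omega> \<T> k) \<epsilon> H \<Delta>t u U u' U'"
    then have "U' \<in> C0 \<Omega>" by (simp add: scheme_step_def)
    then show "energy \<Omega> \<epsilon> B u' (l2_proj \<Omega> (fe_space \<Omega> \<T> k) U') \<le> energy \<Omega> \<epsilon> B u' U'"
      by (rule energy_l2_proj_le)
    show "energy \<Omega> \<epsilon> B u' U' = energy \<Omega> \<epsilon> B u P
        - 1 / \<Delta>t * (l2_norm \<Omega> (\<lambda>x. u' x - u x))\<^sup>2
        - 1/2 * dir (\<lambda>x. u' x - u x) (\<lambda>x. u' x - u x)
        - (l2_norm \<Omega> (\<lambda>x. U' x - P x))\<^sup>2"
      by (rule energy_law[OF step])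
  qed
qed

end
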